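(* If $\kappa\subseteq\mathbb{N}\times\mathbb{N}$ is a Schur bounded pattern, then the Schur idempotent $\Phi_\kappa$ belongs to $\mathfrak{H}$.
   Context: Let $H=\ell^2=\ell^2(\mathbb{N})$ and let $\mathcal{D}\subseteq\mathcal{B}(H)$ be the masa of operators that are diagonal with respect to the canonical basis; operators on $H$ are identified with their matrices with respect to this basis. A Schur multiplier is a weak* continuous $\mathcal{D}$-bimodule (linear) map on $\mathcal{B}(H)$. A function $\varphi:\mathbb{N}\times\mathbb{N}\to\mathbb{C}$ is called a Schur multiplier if entrywise multiplication $(t_{i,j})\mapsto(\varphi(i,j)t_{i,j})$ maps (matrices of) bounded operators on $\ell^2$ to bounded operators on $\ell^2$ (and so defines a weak* continuous $\mathcal{D}$-bimodule map on $\mathcal{B}(H)$). A Schur bounded pattern is a subset $\kappa\subseteq\mathbb{N}\times\mathbb{N}$ such that every bounded function $\varphi:\mathbb{N}\times\mathbb{N}\to\mathbb{C}$ supported on $\kappa$ is a Schur multiplier. For such $\kappa$, $\Phi_\kappa$ is the map on $\mathcal{B}(H)$ of entrywise multiplication by the matrix $(a_{i,j})$ with $a_{i,j}=1$ if $(i,j)\in\kappa$ and $a_{i,j}=0$ otherwise. A Schur idempotent is a Schur multiplier $\Phi$ with $\Phi\circ\Phi=\Phi$; put $\Phi^\perp=\mathrm{id}-\Phi$ and let $\operatorname{Ran}\Phi$ be the range of $\Phi$. For a subspace $\mathcal{X}\subseteq\mathcal{B}(H)$ and $T\in\mathcal{B}(H)$, put $\alpha(T,\mathcal{X})=\sup\{\inf_{X\in\mathcal{X}}\|T\xi-X\xi\|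 : \xi\in H,\ \|\xi\|=1\}$. $\mathfrak{H}$ is the set of Schur idempotents $\Phi$ for which there is $\lambda>0$ with $\|\Phi^\perp(T)\|\leq\lambda\,\alpha(T,\operatorname{Ran}\Phi)$ for all $T\in\mathcal{B}(H)$. *)

theory Defs
  imports "HOL-Analysis.Analysis"
begin

typedef ell2 = "{x :: nat \<Rightarrow> complex. summable (\<lambda>i. (cmod (x i))\<^sup>2)}"
  morphisms coord Abs_ell2
  by (rule exI[of _ "\<lambda>_. 0"]) simp

setup_lifting type_definition_ell2

lemma summable_sq_add:
  fixes x y :: "nat \<Rightarrow> complex"
  assumes "summable (\<lambda>i. (cmod (x i))\<^sup>2)" "summable (\<lambda>i. (cmod (y i))\<^sup>2)"
  shows "summable (\<lambda>i. (cmod (x i + y i))\<^sup>2)"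
proof (rule summable_comparison_test')
  show "summable (\<lambda>i. 2 * (cmod (x i))\<^sup>2 + 2 * (cmod (y i))\<^sup>2)"
    using assms by (intro summable_add summable_mult)
  fix i :: nat
  have "(cmod (x i + y i))\<^sup>2 \<le> (cmod (x i) + cmod (y i))\<^sup>2"
    by (intro power_mono norm_triangle_ineq norm_ge_zero)
  also have "\<dots> \<le> 2 * (cmod (x i))\<^sup>2 + 2 * (cmod (y i))\<^sup>2"
    using zero_le_power2[of "cmod (x i) - cmod (y i)"]
    by (simp add: power2_eq_square algebra_simps)
  finally show "norm ((cmod (x i + y i))\<^sup>2) \<le> 2 * (cmod (x i))\<^sup>2 + 2 * (cmod (y i))\<^sup>2"
    by simp
qed

lemma summable_sq_mult:
  fixes x :: "nat \<Rightarrow> complex"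
  assumes "summable (\<lambda>i. (cmod (x i))\<^sup>2)"
  shows "summable (\<lambda>i. (cmod (c * x i))\<^sup>2)"
  using summable_mult[OF assms, of "(cmod c)\<^sup>2"] by (simp add: norm_mult power_mult_distrib)

lemma summable_prod:
  fixes a b :: "nat \<Rightarrow> real"
  assumes "summable (\<lambda>i. (a i)\<^sup>2)" "summable (\<lambda>i. (b i)\<^sup>2)"
  shows "summable (\<lambda>i. a i * b i)"
proof (rule summable_comparison_test')
  show "summable (\<lambda>i. (a i)\<^sup>2 + (b i)\<^sup>2)"
    using assms by (rule summable_add)
  fix i :: nat
  have "2 * (\<bar>a i\<bar> * \<bar>b i\<bar>) \<le> (a i)\<^sup>2 + (b i)\<^sup>2"
    using zero_le_power2[of "\<bar>a i\<bar> - \<bar>b i\<bar>"]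
    by (simp add: power2_eq_square algebra_simps)
  moreover have "0 \<le> \<bar>a i\<bar> * \<bar>b i\<bar>" by simp
  ultimately show "norm (a i * b i) \<le> (a i)\<^sup>2 + (b i)\<^sup>2"
    unfolding real_norm_def abs_mult by linarith
qed

lemma summable_inner_seq:
  fixes x y :: "nat \<Rightarrow> complex"
  assumes "summable (\<lambda>i. (cmod (x i))\<^sup>2)" "summable (\<lambda>i. (cmod (y i))\<^sup>2)"
  shows "summable (\<lambda>i. x i \<bullet> y i)"
  by (rule summable_comparison_test'[OF summable_prod[OF assms]])
     (simp add: Cauchy_Schwarz_ineq2)

lift_definition scaleC :: "complex \<Rightarrow> ell2 \<Rightarrow> ell2" (infixr "*\<^sub>C" 75)
  is "\<lambda>c x i. c * x i" by (rule summable_sq_mult)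

instantiation ell2 :: real_inner
begin

lift_definition zero_ell2 :: ell2 is "\<lambda>_. 0" by simp

lift_definition plus_ell2 :: "ell2 \<Rightarrow> ell2 \<Rightarrow> ell2" is "\<lambda>x y i. x i + y i"
  by (rule summable_sq_add)

lift_definition uminus_ell2 :: "ell2 \<Rightarrow> ell2" is "\<lambda>x i. - x i" by simp

lift_definition minus_ell2 :: "ell2 \<Rightarrow> ell2 \<Rightarrow> ell2" is "\<lambda>x y i. x i - y i"
  by (drule (1) summable_sq_add[of _ "\<lambda>i. - _ i", simplified]) simp

lift_definition scaleR_ell2 :: "real \<Rightarrow> ell2 \<Rightarrow> ell2" is "\<lambda>r x i. complex_of_real r * x i"
  by (rule summable_sq_mult)

text \<open>
  The \<^class>\<open>real_inner\<close> inner product is the real part of the complex inner product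
  \<open>cinner\<close> below; both induce the usual norm.
\<close>

lift_definition inner_ell2 :: "ell2 \<Rightarrow> ell2 \<Rightarrow> real" is "\<lambda>x y. \<Sum>i. x i \<bullet> y i" .

lift_definition norm_ell2 :: "ell2 \<Rightarrow> real" is "\<lambda>x. sqrt (\<Sum>i. (cmod (x i))\<^sup>2)" .

definition sgn_ell2 :: "ell2 \<Rightarrow> ell2" where "sgn_ell2 x = scaleR (inverse (norm x)) x"

definition dist_ell2 :: "ell2 \<Rightarrow> ell2 \<Rightarrow> real" where "dist_ell2 x y = norm (x - y)"

definition uniformity_ell2 :: "(ell2 \<times> ell2) filter" where
  "uniformity_ell2 = (INF e\<in>{0 <..}. principal {(x, y). dist x y < e})"

definition open_ell2 :: "ell2 set \<Rightarrow> bool" where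
  "open_ell2 U \<longleftrightarrow> (\<forall>x\<in>U. \<forall>\<^sub>F (x', y) in uniformity. x' = x \<longrightarrow> y \<in> U)"

instance
proof
  fix x y z :: ell2 and a b r :: real and U :: "ell2 set"
  show "dist x y = norm (x - y)" by (rule dist_ell2_def)
  show "sgn x = scaleR (inverse (norm x)) x" by (rule sgn_ell2_def)
  show "(uniformity :: (ell2 \<times> ell2) filter) = (INF e\<in>{0 <..}. principal {(x, y). dist x y < e})"
    by (rule uniformity_ell2_def)
  show "open U \<longleftrightarrow> (\<forall>x\<in>U. \<forall>\<^sub>F (x', y) in uniformity. x' = x \<longrightarrow> y \<in> U)"
    by (rule open_ell2_def)
  show "x + y + z = x + (y + z)" by transfer (simp add: add.assoc)
  show "x + y = y + x" by transfer (simp add: add.commute)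
  show "0 + x = x" by transfer simp
  show "- x + x = 0" by transfer simp
  show "x - y = x + - y" by transfer simp
  show "a *\<^sub>R (x + y) = a *\<^sub>R x + a *\<^sub>R y" by transfer (simp add: algebra_simps)
  show "(a + b) *\<^sub>R x = a *\<^sub>R x + b *\<^sub>R x" by transfer (simp add: algebra_simps)
  show "a *\<^sub>R b *\<^sub>R x = (a * b) *\<^sub>R x" by transfer (simp add: algebra_simps)
  show "1 *\<^sub>R x = x" by transfer simp
  show "x \<bullet> y = y \<bullet> x" by transfer (simp add: inner_commute)
  show "(x + y) \<bullet> z = x \<bullet> z + y \<bullet> z"
    by transfer (simp add: inner_add_left suminf_add summable_inner_seq)
  show "r *\<^sub>R x \<bullet> y = r * (x \<bullet> y)"
    by transfer (simp add: scaleR_conv_of_real[symmetric] suminf_mult summable_inner_seq)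
  show "0 \<le> x \<bullet> x"
    by transfer (simp add: power2_norm_eq_inner[symmetric] suminf_nonneg)
  show "x \<bullet> x = 0 \<longleftrightarrow> x = 0"
    by transfer (auto simp: power2_norm_eq_inner[symmetric] suminf_eq_zero_iff)
  show "norm x = sqrt (x \<bullet> x)"
    by transfer (simp add: power2_norm_eq_inner)
qed

end

lift_definition cinner :: "ell2 \<Rightarrow> ell2 \<Rightarrow> complex" is "\<lambda>x y. \<Sum>i. x i * cnj (y i)" .

lift_definition basis_vec :: "nat \<Rightarrow> ell2" is "\<lambda>j i. if i = j then 1 else 0"
  by (rule summable_finite[of "{_}"]) auto

lemma norm_scaleC: "norm (c *\<^sub>C x) = cmod c * norm x"
  by transfer (simp add: norm_mult power_mult_distrib suminf_mult real_sqrt_mult)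

lemma bounded_linear_scaleC: "bounded_linear (\<lambda>x. c *\<^sub>C x)"
proof (rule bounded_linear_intro[of _ "cmod c"])
  show "c *\<^sub>C (x + y) = c *\<^sub>C x + c *\<^sub>C y" for x y by transfer (simp add: algebra_simps)
  show "c *\<^sub>C r *\<^sub>R x = r *\<^sub>R c *\<^sub>C x" for r x by transfer (simp add: algebra_simps)
  show "norm (c *\<^sub>C x) \<le> norm x * cmod c" for x by (simp add: norm_scaleC)
qed

text \<open>
  The type \<^typ>\<open>ell2 \<Rightarrow>\<^sub>L ell2\<close> consists of the bounded real-linear maps, and its norm is the
  operator norm.  \<open>B(H)\<close> is the subset of the complex-linear ones; maps on \<open>B(H)\<close> are functions
  on the whole type of which only the values on \<open>B(H)\<close> matter.
\<close>

type_synonym ell2_op = "ell2 \<Rightarrow>\<^sub>L ell2"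

definition BH :: "ell2_op set" where
  "BH = {T. \<forall>c x. blinfun_apply T (c *\<^sub>C x) = c *\<^sub>C blinfun_apply T x}"

definition scaleC_op :: "complex \<Rightarrow> ell2_op \<Rightarrow> ell2_op" where
  "scaleC_op c T = Blinfun (\<lambda>x. c *\<^sub>C blinfun_apply T x)"

lemma blinfun_apply_scaleC_op: "blinfun_apply (scaleC_op c T) x = c *\<^sub>C blinfun_apply T x"
  unfolding scaleC_op_def
  by (subst bounded_linear_Blinfun_apply)
     (rule bounded_linear_compose[OF bounded_linear_scaleC blinfun.bounded_linear_right] refl)+

definition entry :: "ell2_op \<Rightarrow> nat \<times> nat \<Rightarrow> complex" where
  "entry T = (\<lambda>(i, j). cinner (blinfun_apply T (basis_vec j)) (basis_vec i))"

definition diagonal_ops :: "ell2_op set" where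
  "diagonal_ops = {D \<in> BH. \<forall>i j. i \<noteq> j \<longrightarrow> entry D (i, j) = 0}"

text \<open>
  The weak* topology of \<open>B(H)\<close> as the dual of the trace class operators: the weak*
  continuous functionals are exactly the series \<open>T \<mapsto> \<Sum>n. \<langle>T \<xi>\<^sub>n, \<eta>\<^sub>n\<rangle>\<close> with
  \<open>(\<xi>\<^sub>n)\<close>, \<open>(\<eta>\<^sub>n)\<close> square-summable in norm, that is, \<open>T \<mapsto> tr (T A)\<close> with \<open>A\<close> of trace class.
\<close>

definition weak_star_functionals :: "(ell2_op \<Rightarrow> complex) set" where
  "weak_star_functionals =
     {(\<lambda>T. \<Sum>n. cinner (blinfun_apply T (\<xi> n)) (\<eta> n)) | \<xi> \<eta>.
        summable (\<lambda>n. (norm (\<xi> n))\<^sup>2) \<and> summable (\<lambda>n. (norm (\<eta> n))\<^sup>2)}"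

definition weak_star :: "ell2_op topology" where
  "weak_star = topology_generated_by
     {{T \<in> BH. \<omega> T \<in> U} | \<omega> U. \<omega> \<in> weak_star_functionals \<and> open U}"

lemma topspace_weak_star: "topspace weak_star = BH"
proof -
  have "(\<lambda>T. \<Sum>n. cinner (blinfun_apply T 0) 0) \<in> weak_star_functionals"
    unfolding weak_star_functionals_def
    by (intro CollectI exI[of _ "\<lambda>_. 0"]) simp
  then show ?thesis
    unfolding weak_star_def topology_generated_by_topspace by blast
qed

definition clinear_map :: "(ell2_op \<Rightarrow> ell2_op) \<Rightarrow> bool" where
  "clinear_map \<Phi> \<longleftrightarrow>
     (\<forall>T\<in>BH. \<Phi> T \<in> BH) \<and>
     (\<forall>S\<in>BH. \<forall>T\<in>BH. \<Phi> (S + T) = \<Phi> S + \<Phi> T) \<and>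
     (\<forall>c. \<forall>T\<in>BH. \<Phi> (scaleC_op c T) = scaleC_op c (\<Phi> T))"

definition diagonal_bimodule_map :: "(ell2_op \<Rightarrow> ell2_op) \<Rightarrow> bool" where
  "diagonal_bimodule_map \<Phi> \<longleftrightarrow>
     clinear_map \<Phi> \<and>
     (\<forall>D\<in>diagonal_ops. \<forall>E\<in>diagonal_ops. \<forall>T\<in>BH. \<Phi> (D o\<^sub>L T o\<^sub>L E) = D o\<^sub>L \<Phi> T o\<^sub>L E)"

definition schur_multiplier :: "(ell2_op \<Rightarrow> ell2_op) \<Rightarrow> bool" where
  "schur_multiplier \<Phi> \<longleftrightarrow>
     diagonal_bimodule_map \<Phi> \<and> continuous_map weak_star weak_star \<Phi>"

definition schur_idempotent :: "(ell2_op \<Rightarrow> ell2_op) \<Rightarrow> bool" where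
  "schur_idempotent \<Phi> \<longleftrightarrow> schur_multiplier \<Phi> \<and> (\<forall>T\<in>BH. \<Phi> (\<Phi> T) = \<Phi> T)"

definition is_schur_product :: "(nat \<times> nat \<Rightarrow> complex) \<Rightarrow> ell2_op \<Rightarrow> ell2_op \<Rightarrow> bool" where
  "is_schur_product \<phi> T S \<longleftrightarrow> S \<in> BH \<and> (\<forall>p. entry S p = \<phi> p * entry T p)"

definition schur_multiplier_function :: "(nat \<times> nat \<Rightarrow> complex) \<Rightarrow> bool" where
  "schur_multiplier_function \<phi> \<longleftrightarrow> (\<forall>T\<in>BH. \<exists>S. is_schur_product \<phi> T S)"

text \<open>
  Operators in \<^const>\<open>BH\<close> are determined by their matrices, so the description below is proper
  on \<^const>\<open>BH\<close> whenever \<open>\<phi>\<close> is a Schur multiplier function.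
\<close>

definition entrywise_mult :: "(nat \<times> nat \<Rightarrow> complex) \<Rightarrow> ell2_op \<Rightarrow> ell2_op" where
  "entrywise_mult \<phi> T = (THE S. is_schur_product \<phi> T S)"

definition schur_bounded_pattern :: "(nat \<times> nat) set \<Rightarrow> bool" where
  "schur_bounded_pattern \<kappa> \<longleftrightarrow>
     (\<forall>\<phi> :: nat \<times> nat \<Rightarrow> complex.
        bounded (range \<phi>) \<and> (\<forall>p. p \<notin> \<kappa> \<longrightarrow> \<phi> p = 0) \<longrightarrow> schur_multiplier_function \<phi>)"

definition pattern_map :: "(nat \<times> nat) set \<Rightarrow> ell2_op \<Rightarrow> ell2_op" where
  "pattern_map \<kappa> = entrywise_mult (indicator \<kappa>)"

definition ran :: "(ell2_op \<Rightarrow> ell2_op) \<Rightarrow> ell2_op set" where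
  "ran \<Phi> = \<Phi> ` BH"

definition perp :: "(ell2_op \<Rightarrow> ell2_op) \<Rightarrow> ell2_op \<Rightarrow> ell2_op" where
  "perp \<Phi> T = T - \<Phi> T"

definition alpha :: "ell2_op \<Rightarrow> ell2_op set \<Rightarrow> real" where
  "alpha T \<X> = (SUP \<xi>\<in>{\<xi>. norm \<xi> = 1}. INF X\<in>\<X>. norm (blinfun_apply T \<xi> - blinfun_apply X \<xi>))"

definition frakH :: "(ell2_op \<Rightarrow> ell2_op) set" where
  "frakH = {\<Phi>. schur_idempotent \<Phi> \<and> (\<exists>l>0. \<forall>T\<in>BH. norm (perp \<Phi> T) \<le> l * alpha T (ran \<Phi>))}"

end

theory Submission
  imports Defs "HOL-Complex_Analysis.Great_Picard"
begin

text \<open>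
  A bounded pattern splits as \<open>\<kappa> = R \<union> C\<close> with at most \<open>N\<close> entries in every row of \<open>R\<close> and in every
  column of \<open>C\<close>. Otherwise, for every \<open>D\<close>, arbitrarily far out there is a finite rectangle in which
  all rows and columns meet \<open>\<kappa>\<close> at least \<open>D\<close> times; a second moment computation with random signs
  turns it into a matrix of norm at most \<open>\<surd>3\<close> whose Schur product with some signs supported on \<open>\<kappa>\<close>
  has norm at least \<open>\<surd>(D/8)\<close>. The direct sum of disjoint such blocks contradicts Schur boundedness.

  Given the splitting, choose random sets \<open>A\<^sub>0, B\<^sub>0\<close>, each index independently with probability \<open>1/2\<close>.
  Let \<open>A\<close> be the set of \<open>i \<in> A\<^sub>0\<close> whose row of \<open>R\<close> misses \<open>B\<^sub>0\<close>, and \<open>B\<close> the set of \<open>j \<in> B\<^sub>0\<close> whose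
  column of \<open>C\<close> misses \<open>A\<^sub>0\<close>. Then \<open>A \<times> B\<close> avoids \<open>\<kappa>\<close>, so the norm of \<open>P\<^sub>A T P\<^sub>B\<close> is at most
  \<open>\<alpha>(T, Ran \<Phi>)\<close>. A pair \<open>(i, j) \<notin> \<kappa>\<close> lies in \<open>A \<times> B\<close> with probability \<open>2\<close> to the power
  \<open>-2 - |R\<^sub>i| - |C\<^sub>j|\<close>, a product of a function of \<open>i\<close> and a function of \<open>j\<close>, so rescaling rows and
  columns of the expectation gives \<open>T - \<Phi>(T)\<close>, with constant \<open>4\<close> to the power \<open>N + 1\<close>.
\<close>

section \<open>Coordinates, matrix entries and Schur products\<close>

lemma coord_basis_vec: "coord (basis_vec j) i = (if i = j then 1 else 0)"
  by (simp add: basis_vec.rep_eq)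

lemma summable_coord: "summable (\<lambda>i. (cmod (coord x i))\<^sup>2)"
  using coord[of x] by simp

lemma ell2_eqI: "(\<And>i. coord x i = coord y i) \<Longrightarrow> x = y"
  by (metis coord_inject ext)

lemma coord_simps [simp]:
  "coord 0 i = 0" "coord (x + y) i = coord x i + coord y i"
  "coord (x - y) i = coord x i - coord y i" "coord (- x) i = - coord x i"
  "coord (r *\<^sub>R x) i = complex_of_real r * coord x i" "coord (c *\<^sub>C x) i = c * coord x i"
  by (simp_all add: zero_ell2.rep_eq plus_ell2.rep_eq minus_ell2.rep_eq uminus_ell2.rep_eq
      scaleR_ell2.rep_eq scaleC.rep_eq)

lemma coord_sum [simp]: "coord (sum f A) i = (\<Sum>a\<in>A. coord (f a) i)"
  by (induction A rule: infinite_finite_induct) auto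

lemma norm_ell2_squared: "(norm x)\<^sup>2 = (\<Sum>i. (cmod (coord x i))\<^sup>2)"
  by (simp add: norm_ell2.rep_eq suminf_nonneg summable_coord)

lemma sum_cmod_coord_le: "finite A \<Longrightarrow> (\<Sum>i\<in>A. (cmod (coord x i))\<^sup>2) \<le> (norm x)\<^sup>2"
  unfolding norm_ell2_squared by (rule sum_le_suminf) (auto simp: summable_coord)

lemma cmod_coord_le: "cmod (coord x i) \<le> norm x"
  using sum_cmod_coord_le[of "{i}" x] by (simp add: abs_le_square_iff[symmetric])

lemma bounded_linear_coord: "bounded_linear (\<lambda>x. coord x i)"
  by (rule bounded_linear_intro[of _ 1]) (auto simp: scaleR_conv_of_real cmod_coord_le)

lemma inner_basis_vec: "basis_vec i \<bullet> basis_vec j = (if i = j then 1 else 0)"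
proof -
  have "(\<Sum>k. coord (basis_vec i) k \<bullet> coord (basis_vec j) k)
      = (\<Sum>k\<in>{i}. coord (basis_vec i) k \<bullet> coord (basis_vec j) k)"
    by (rule suminf_finite) (auto simp: coord_basis_vec)
  then show ?thesis by (simp add: inner_ell2.rep_eq coord_basis_vec)
qed

lemma norm_basis_vec [simp]: "norm (basis_vec j) = 1"
  by (simp add: norm_eq_sqrt_inner inner_basis_vec)

lemma cinner_basis_vec: "cinner x (basis_vec i) = coord x i"
proof -
  have "(\<Sum>k. coord x k * cnj (coord (basis_vec i) k))
      = (\<Sum>k\<in>{i}. coord x k * cnj (coord (basis_vec i) k))"
    by (rule suminf_finite) (auto simp: coord_basis_vec)
  then show ?thesis by (simp add: cinner.rep_eq coord_basis_vec)
qed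

lemma entry_eq_coord: "entry T (i, j) = coord (blinfun_apply T (basis_vec j)) i"
  by (simp add: entry_def cinner_basis_vec)

section \<open>Coordinate projections and finite truncations\<close>

lift_definition proj :: "nat set \<Rightarrow> ell2 \<Rightarrow> ell2" is "\<lambda>A x i. if i \<in> A then x i else 0"
  by (rule summable_comparison_test') auto

lemma coord_proj [simp]: "coord (proj A x) i = (if i \<in> A then coord x i else 0)"
  by (simp add: proj.rep_eq)

lemma norm_proj_le: "norm (proj A x) \<le> norm x"
proof -
  have "(norm (proj A x))\<^sup>2 \<le> (norm x)\<^sup>2"
    unfolding norm_ell2_squared
    by (rule suminf_le[OF _ summable_coord summable_coord]) simp
  then show ?thesis by (simp add: abs_le_square_iff[symmetric])
qed

lemma inner_proj: "proj A x \<bullet> y = x \<bullet> proj A y"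
  unfolding inner_ell2.rep_eq by (rule arg_cong[of _ _ suminf]) auto

lemma proj_finite_eq_sum:
  assumes "finite A" shows "proj A x = (\<Sum>j\<in>A. coord x j *\<^sub>C basis_vec j)"
  by (rule ell2_eqI) (use assms in \<open>simp add: coord_basis_vec if_distrib cong: if_cong\<close>)

lemma norm_diff_proj_squared:
  "(norm (x - proj {..<n} x))\<^sup>2 = (norm x)\<^sup>2 - (\<Sum>i<n. (cmod (coord x i))\<^sup>2)"
proof -
  let ?f = "\<lambda>i. (cmod (coord (x - proj {..<n} x) i))\<^sup>2"
  have "(norm (x - proj {..<n} x))\<^sup>2 = (\<Sum>i. ?f (i + n)) + (\<Sum>i<n. ?f i)"
    unfolding norm_ell2_squared by (rule suminf_split_initial_segment[OF summable_coord])
  also have "\<dots> = (\<Sum>i. (cmod (coord x (i + n)))\<^sup>2)" by simp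
  also have "\<dots> = (norm x)\<^sup>2 - (\<Sum>i<n. (cmod (coord x i))\<^sup>2)"
    unfolding norm_ell2_squared by (rule suminf_minus_initial_segment[OF summable_coord])
  finally show ?thesis .
qed

lemma proj_lessThan_tendsto: "(\<lambda>n. proj {..<n} x) \<longlonglongrightarrow> x"
proof -
  have "(\<lambda>n. (norm x)\<^sup>2 - (\<Sum>i<n. (cmod (coord x i))\<^sup>2)) \<longlonglongrightarrow> (norm x)\<^sup>2 - (norm x)\<^sup>2"
    unfolding norm_ell2_squared by (intro tendsto_intros summable_LIMSEQ summable_coord)
  then have "(\<lambda>n. (norm (x - proj {..<n} x))\<^sup>2) \<longlonglongrightarrow> 0"
    by (simp add: norm_diff_proj_squared)
  then have "(\<lambda>n. sqrt ((norm (x - proj {..<n} x))\<^sup>2)) \<longlonglongrightarrow> sqrt 0"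
    by (rule tendsto_real_sqrt)
  then have "(\<lambda>n. norm (proj {..<n} x - x)) \<longlonglongrightarrow> 0"
    by (simp add: norm_minus_commute)
  then show ?thesis by (simp add: LIM_zero_iff tendsto_norm_zero_iff)
qed

section \<open>Operators and their matrices\<close>

lemma BH_scaleC: "T \<in> BH \<Longrightarrow> blinfun_apply T (c *\<^sub>C x) = c *\<^sub>C blinfun_apply T x"
  by (simp add: BH_def)

lemma apply_proj_finite:
  assumes "T \<in> BH" "finite A"
  shows "blinfun_apply T (proj A x) = (\<Sum>j\<in>A. coord x j *\<^sub>C blinfun_apply T (basis_vec j))"
  using assms by (simp add: proj_finite_eq_sum blinfun.sum_right BH_scaleC)

lemma apply_basis_tendsto:
  assumes "T \<in> BH"
  shows "(\<lambda>n. \<Sum>j<n. coord x j *\<^sub>C blinfun_apply T (basis_vec j)) \<longlonglongrightarrow> blinfun_apply T x"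
  using blinfun.tendsto[OF tendsto_const proj_lessThan_tendsto, of T x]
  by (simp add: apply_proj_finite[OF assms])

text \<open>Truncations of \<open>x\<close> converge to \<open>x\<close> and coordinates are
  continuous, so a bounded complex-linear operator acts as its matrix even on infinite vectors. This
  is why identities in \<open>BH\<close> can be checked on entries.\<close>

lemma coord_apply_sums:
  assumes "T \<in> BH"
  shows "(\<lambda>j. entry T (i, j) * coord x j) sums coord (blinfun_apply T x) i"
  using bounded_linear.tendsto[OF bounded_linear_coord apply_basis_tendsto[OF assms]]
  by (simp add: sums_def entry_eq_coord mult.commute)

lemma BH_eqI:
  assumes "S \<in> BH" "T \<in> BH" "\<And>i j. entry S (i, j) = entry T (i, j)"
  shows "S = T"
proof (rule blinfun_eqI, rule ell2_eqI)
  fix x i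
  show "coord (blinfun_apply S x) i = coord (blinfun_apply T x) i"
    using coord_apply_sums[OF assms(1), of i x] coord_apply_sums[OF assms(2), of i x] assms(3)
    by (simp add: sums_unique2)
qed

lemma is_schur_product_unique:
  "is_schur_product \<phi> T S \<Longrightarrow> is_schur_product \<phi> T S' \<Longrightarrow> S = S'"
  unfolding is_schur_product_def by (auto intro: BH_eqI)

lemma entrywise_mult_eqI: "is_schur_product \<phi> T S \<Longrightarrow> entrywise_mult \<phi> T = S"
  unfolding entrywise_mult_def by (rule the_equality) (auto intro: is_schur_product_unique)

lemma is_schur_product_entrywise_mult:
  assumes "schur_multiplier_function \<phi>" "T \<in> BH"
  shows "is_schur_product \<phi> T (entrywise_mult \<phi> T)"
  using assms unfolding schur_multiplier_function_def by (metis entrywise_mult_eqI)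

lemma BH_zero [simp]: "0 \<in> BH"
  by (auto simp: BH_def intro: ell2_eqI)

lemma BH_add: "S \<in> BH \<Longrightarrow> T \<in> BH \<Longrightarrow> S + T \<in> BH"
  by (auto simp: BH_def blinfun.add_left algebra_simps intro!: ell2_eqI)

lemma BH_diff: "S \<in> BH \<Longrightarrow> T \<in> BH \<Longrightarrow> S - T \<in> BH"
  by (auto simp: BH_def blinfun.diff_left algebra_simps intro!: ell2_eqI)

lemma BH_compose: "S \<in> BH \<Longrightarrow> T \<in> BH \<Longrightarrow> S o\<^sub>L T \<in> BH"
  by (auto simp: BH_def)

lemma BH_scaleC_op: "T \<in> BH \<Longrightarrow> scaleC_op c T \<in> BH"
  by (auto simp: BH_def blinfun_apply_scaleC_op algebra_simps intro!: ell2_eqI)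

lemma entry_zero [simp]: "entry 0 p = 0"
  by (cases p) (simp add: entry_eq_coord)

lemma entry_add: "entry (S + T) p = entry S p + entry T p"
  by (cases p) (simp add: entry_eq_coord blinfun.add_left)

lemma entry_diff: "entry (S - T) p = entry S p - entry T p"
  by (cases p) (simp add: entry_eq_coord blinfun.diff_left)

lemma entry_scaleC_op: "entry (scaleC_op c T) p = c * entry T p"
  by (cases p) (simp add: entry_eq_coord blinfun_apply_scaleC_op)

lemma coord_diagonal_op:
  assumes "D \<in> diagonal_ops"
  shows "coord (blinfun_apply D x) i = entry D (i, i) * coord x i"
proof -
  have "(\<lambda>j. entry D (i, j) * coord x j) sums (\<Sum>j\<in>{i}. entry D (i, j) * coord x j)"
    using assms by (intro sums_finite) (auto simp: diagonal_ops_def)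
  moreover have "D \<in> BH" using assms by (simp add: diagonal_ops_def)
  ultimately show ?thesis using coord_apply_sums[of D i x] sums_unique2 by fastforce
qed

lemma entry_diagonal_compose:
  assumes "D \<in> diagonal_ops" "E \<in> diagonal_ops" "T \<in> BH"
  shows "entry (D o\<^sub>L T o\<^sub>L E) (i, j) = entry D (i, i) * entry T (i, j) * entry E (j, j)"
proof -
  have "blinfun_apply E (basis_vec j) = entry E (j, j) *\<^sub>C basis_vec j"
    by (rule ell2_eqI) (auto simp: coord_diagonal_op[OF assms(2)] coord_basis_vec)
  then show ?thesis
    by (simp add: entry_eq_coord[of "D o\<^sub>L T o\<^sub>L E"] coord_diagonal_op[OF assms(1)]
        BH_scaleC[OF assms(3)] entry_eq_coord[of T])
qed

lemma diagonal_bimodule_map_entrywise_mult: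
  assumes "schur_multiplier_function \<phi>"
  shows "diagonal_bimodule_map (entrywise_mult \<phi>)"
proof -
  have sp: "entrywise_mult \<phi> T \<in> BH" "entry (entrywise_mult \<phi> T) p = \<phi> p * entry T p"
    if "T \<in> BH" for T p
    using is_schur_product_entrywise_mult[OF assms that] unfolding is_schur_product_def by blast+
  show ?thesis
    unfolding diagonal_bimodule_map_def clinear_map_def
  proof (intro conjI ballI allI)
    fix S T assume "S \<in> BH" "T \<in> BH"
    then show "entrywise_mult \<phi> (S + T) = entrywise_mult \<phi> S + entrywise_mult \<phi> T"
      by (intro BH_eqI) (simp_all add: sp BH_add entry_add algebra_simps)
  next
    fix c T assume "T \<in> BH"
    then show "entrywise_mult \<phi> (scaleC_op c T) = scaleC_op c (entrywise_mult \<phi> T)"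
      by (intro BH_eqI) (simp_all add: sp BH_scaleC_op entry_scaleC_op)
  next
    fix D E T assume *: "D \<in> diagonal_ops" "E \<in> diagonal_ops" "T \<in> BH"
    then have "D \<in> BH" "E \<in> BH" by (auto simp: diagonal_ops_def)
    with * show "entrywise_mult \<phi> (D o\<^sub>L T o\<^sub>L E) = D o\<^sub>L entrywise_mult \<phi> T o\<^sub>L E"
      by (intro BH_eqI) (simp_all add: sp BH_compose entry_diagonal_compose)
  qed (simp add: sp)
qed

section \<open>Random signs on a dense finite rectangle\<close>

text \<open>The inner product of \<open>x + c *\<^sub>R A x = 0\<close> with \<open>x\<close> forces
  \<open>x = 0\<close>, so the map is injective; it preserves the finite-dimensional space
  \<open>span S\<close>, hence is onto there. This supplies the inverse of 1 + cA column by
  column.\<close>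

lemma id_plus_psd_surj:
  fixes A :: "'a::real_inner \<Rightarrow> 'a"
  assumes "linear A" "finite S" and A_span: "\<And>x. A x \<in> span S" and psd: "\<And>x. 0 \<le> x \<bullet> A x"
    and "0 \<le> c" "e \<in> span S"
  shows "\<exists>v. v + c *\<^sub>R A v = e"
proof -
  define f where "f v = v + c *\<^sub>R A v" for v
  interpret A: linear A by fact
  have lin: "linear f"
    by (rule linearI) (auto simp: f_def A.add A.scale algebra_simps)
  have "x = 0" if "f x = 0" for x
  proof -
    have "x \<bullet> x + c * (x \<bullet> A x) = 0"
      using arg_cong[OF that, of "\<lambda>y. x \<bullet> y"] by (simp add: f_def inner_add_right)
    moreover have "0 \<le> c * (x \<bullet> A x)" using psd \<open>0 \<le> c\<close> by simp
    ultimately have "x \<bullet> x = 0" using inner_ge_zero[of x] by linarith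
    then show ?thesis by simp
  qed
  then have inj: "inj f" by (simp add: linear_injective_0[OF lin])
  obtain B where B: "B \<subseteq> S" "independent B" "S \<subseteq> span B"
    using maximal_independent_subset by blast
  have "finite B" using B(1) \<open>finite S\<close> finite_subset by blast
  have spanB: "span B = span S"
    by (rule subset_antisym[OF span_mono[OF B(1)] span_minimal[OF B(3) subspace_span]])
  have indep: "independent (f ` B)"
    by (rule linear_independent_injective_image[OF lin B(2)]) (use inj inj_on_subset in blast)
  have fB: "f ` B \<subseteq> span B"
  proof (intro subsetI, elim imageE)
    fix y x assume "y = f x" "x \<in> B"
    then have "x \<in> span S" by (metis spanB span_base)
    then show "y \<in> span B"
      by (simp add: \<open>y = f x\<close> f_def spanB A_span span_add span_scale)
  qed
  have card: "card (f ` B) = card B"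
    using inj by (meson card_image inj_on_subset subset_UNIV)
  \<comment> \<open>A vector of \<open>B\<close> outside the span of the image of \<open>B\<close>
    could be added to that image, giving more independent vectors in \<open>span B\<close> than its
    dimension.\<close>
  have "B \<subseteq> span (f ` B)"
  proof (intro subsetI, rule ccontr)
    fix b assume b: "b \<in> B" "b \<notin> span (f ` B)"
    have "independent (insert b (f ` B))"
      using b(2) indep by (rule independent_insertI)
    moreover have "insert b (f ` B) \<subseteq> span B"
      using b(1) fB by (auto intro: span_base)
    ultimately have "card (insert b (f ` B)) \<le> card B"
      using independent_span_bound[OF \<open>finite B\<close>] by blast
    moreover have "b \<notin> f ` B" using b(2) span_superset[of "f ` B"] by blast
    ultimately show False using card \<open>finite B\<close> by simp
  qed
  then have "span B \<subseteq> span (f ` B)" by (rule span_minimal) (rule subspace_span)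
  then have "span S \<subseteq> f ` span B" by (simp only: linear_span_image[OF lin] spanB)
  then obtain v where "e = f v" using assms(6) by blast
  then show ?thesis unfolding f_def by blast
qed

text \<open>
  The witness is \<open>b = W (1 + \<delta> W*W)\<^sup>-\<^sup>1\<close>: it replaces \<open>W\<close>, which is bounded only in the mean, by a
  matrix of norm at most \<open>1 / \<surd>(2 \<delta>)\<close> with almost the same diagonal of \<open>W*b\<close>.
\<close>

lemma regularized_matrix:
  fixes w :: "'i \<Rightarrow> nat \<Rightarrow> real"
  assumes "finite A" "finite B" "\<delta> > 0"
  shows "\<exists>b. (\<forall>x. 2 * \<delta> * (\<Sum>i\<in>A. (\<Sum>j\<in>B. b i j * x j)\<^sup>2) \<le> (\<Sum>j\<in>B. (x j)\<^sup>2)) \<and>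
    (\<forall>j\<in>B. (\<Sum>i\<in>A. (w i j)\<^sup>2) - \<delta> * (\<Sum>l\<in>B. (\<Sum>i\<in>A. w i l * w i j)\<^sup>2) \<le> (\<Sum>i\<in>A. w i j * b i j))"
proof -
  \<comment> \<open>\<open>M\<close> is the Gram matrix W*W of the columns and \<open>ap\<close> its
    action; \<open>quad\<close> below is the identity <z, W*W z> = |W z|^2.\<close>
  define M where "M j l = (\<Sum>i\<in>A. w i j * w i l)" for j l
  define ap where "ap z l = (\<Sum>p\<in>B. M l p * z p)" for z l
  have M_sym: "M j l = M l j" for j l by (simp add: M_def mult.commute)
  have ap_add: "ap (\<lambda>p. x p + y p) l = ap x l + ap y l" for x y l
    by (simp add: ap_def algebra_simps sum.distrib)
  have ap_scale: "ap (\<lambda>p. c * x p) l = c * ap x l" for c x l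
    by (simp add: ap_def sum_distrib_left mult_ac)
  have ap_eq: "ap z l = (\<Sum>i\<in>A. w i l * (\<Sum>p\<in>B. w i p * z p))" for z l
    unfolding ap_def M_def sum_distrib_left sum_distrib_right
    by (subst sum.swap) (simp add: mult.assoc)
  have quad: "(\<Sum>l\<in>B. z l * ap z l) = (\<Sum>i\<in>A. (\<Sum>p\<in>B. w i p * z p)\<^sup>2)" for z
    unfolding ap_eq sum_distrib_left power2_eq_square[of "sum _ _"] sum_distrib_right
    by (subst sum.swap) (simp add: mult_ac)
  \<comment> \<open>The system is solved inside \<open>ell2\<close>, where the real span of the
    basis vectors indexed by \<open>B\<close> is a copy of R^B and \<open>F\<close> is
    \<open>ap\<close> acting on it.\<close>
  have "\<exists>v. \<forall>l\<in>B. v l + \<delta> * ap v l = (if l = j then 1 else 0)" if "j \<in> B" for j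
  proof -
    define F where "F x = (\<Sum>l\<in>B. ap (\<lambda>p. x \<bullet> basis_vec p) l *\<^sub>R basis_vec l)" for x
    have "\<exists>v. v + \<delta> *\<^sub>R F v = basis_vec j"
    proof (rule id_plus_psd_surj)
      show "linear F"
        by (rule linearI)
          (simp_all add: F_def inner_add_left ap_add ap_scale scaleR_add_left sum.distrib scaleR_sum_right)
      show "finite (basis_vec ` B)" using assms by simp
      show "F x \<in> span (basis_vec ` B)" for x
        unfolding F_def by (intro span_sum span_scale span_base) auto
      show "0 \<le> x \<bullet> F x" for x
      proof -
        have "x \<bullet> F x = (\<Sum>l\<in>B. (x \<bullet> basis_vec l) * ap (\<lambda>p. x \<bullet> basis_vec p) l)"
          by (simp add: F_def inner_sum_right mult.commute)
        then show ?thesis by (simp add: quad sum_nonneg)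
      qed
    qed (use that assms in \<open>auto intro: span_base\<close>)
    then obtain v where v: "v + \<delta> *\<^sub>R F v = basis_vec j" by blast
    have "v \<bullet> basis_vec l + \<delta> * ap (\<lambda>p. v \<bullet> basis_vec p) l = (if l = j then 1 else 0)"
      if "l \<in> B" for l
    proof -
      have "F v \<bullet> basis_vec l = ap (\<lambda>p. v \<bullet> basis_vec p) l"
        using that assms by (simp add: F_def inner_sum_left inner_basis_vec if_distrib cong: if_cong)
      then show ?thesis
        using arg_cong[OF v, of "\<lambda>y. y \<bullet> basis_vec l"]
        by (simp add: inner_add_left inner_basis_vec eq_commute)
    qed
    then show ?thesis by (intro exI[of _ "\<lambda>l. v \<bullet> basis_vec l"]) simp
  qed
  then have "\<forall>j\<in>B. \<exists>v. \<forall>l\<in>B. v l + \<delta> * ap v l = (if l = j then 1 else 0)" by simp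
  from bchoice[OF this] obtain r where r: "\<And>j l. j \<in> B \<Longrightarrow> l \<in> B \<Longrightarrow> r j l + \<delta> * ap (r j) l = (if l = j then 1 else 0)"
    by blast
  define b where "b i j = (\<Sum>l\<in>B. w i l * r j l)" for i j
  have "2 * \<delta> * (\<Sum>i\<in>A. (\<Sum>j\<in>B. b i j * x j)\<^sup>2) \<le> (\<Sum>j\<in>B. (x j)\<^sup>2)" for x
  proof -
    \<comment> \<open>\<open>v\<close> is the inverse applied to \<open>x\<close>, so x = v + delta
      W*W v on \<open>B\<close> and b x = W v. The bound then reads |v + delta W*W v|^2 \<ge> 2
      delta <v, W*W v>.\<close>
    define v where "v l = (\<Sum>j\<in>B. x j * r j l)" for l
    have ap_v: "ap v l = (\<Sum>j\<in>B. x j * ap (r j) l)" for l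
      unfolding ap_def v_def sum_distrib_left by (subst sum.swap) (simp add: mult_ac)
    have "v l + \<delta> * ap v l = (\<Sum>j\<in>B. x j * (r j l + \<delta> * ap (r j) l))" for l
      unfolding ap_v by (simp add: v_def algebra_simps sum.distrib sum_distrib_left)
    then have x: "x l = v l + \<delta> * ap v l" if "l \<in> B" for l
      using that assms by (simp add: r if_distrib cong: if_cong)
    have "(\<Sum>j\<in>B. b i j * x j) = (\<Sum>p\<in>B. w i p * v p)" for i
      unfolding b_def v_def sum_distrib_left sum_distrib_right by (subst sum.swap) (simp add: mult_ac)
    then have "2 * \<delta> * (\<Sum>i\<in>A. (\<Sum>j\<in>B. b i j * x j)\<^sup>2) = (\<Sum>l\<in>B. 2 * \<delta> * (v l * ap v l))"
      by (simp add: quad sum_distrib_left[symmetric])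
    also have "\<dots> \<le> (\<Sum>j\<in>B. (x j)\<^sup>2)"
    proof (rule sum_mono)
      fix l assume "l \<in> B"
      have "0 \<le> (v l)\<^sup>2 + (\<delta> * ap v l)\<^sup>2" by simp
      then show "2 * \<delta> * (v l * ap v l) \<le> (x l)\<^sup>2"
        unfolding x[OF \<open>l \<in> B\<close>] by (simp add: power2_sum)
    qed
    finally show ?thesis .
  qed
  moreover have "(\<Sum>i\<in>A. (w i j)\<^sup>2) - \<delta> * (\<Sum>l\<in>B. (\<Sum>i\<in>A. w i l * w i j)\<^sup>2) \<le> (\<Sum>i\<in>A. w i j * b i j)"
    if j: "j \<in> B" for j
  proof -
    \<comment> \<open>\<open>z\<close> is column \<open>j\<close> of W*b, so \<open>z j\<close> is
      the diagonal entry to be bounded from below.\<close>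
    define z where "z = ap (r j)"
    have rj: "r j l = (if l = j then 1 else 0) - \<delta> * z l" if "l \<in> B" for l
      using r[OF j that] by (simp add: z_def)
    have z: "z l = M l j - \<delta> * ap z l" for l
    proof -
      have "z l = (\<Sum>p\<in>B. M l p * ((if p = j then 1 else 0) - \<delta> * z p))"
        unfolding z_def ap_def[of "r j" l] by (rule sum.cong) (simp_all add: rj z_def)
      also have "\<dots> = (\<Sum>p\<in>B. (if p = j then M l p else 0) - \<delta> * (M l p * z p))"
        by (rule sum.cong) (auto simp: algebra_simps)
      also have "\<dots> = M l j - \<delta> * ap z l"
        using assms j by (simp add: sum_subtractf ap_def sum_distrib_left)
      finally show ?thesis .
    qed
    \<comment> \<open>If m is column \<open>j\<close> of \<open>M\<close>, then m = z + delta M z.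
      Expanding |m|^2 leaves <m, z> plus delta <z, M z> plus a square, and \<open>M\<close> is
      positive semidefinite.\<close>
    have "(\<Sum>l\<in>B. M l j * z l) \<le> (\<Sum>l\<in>B. (M l j)\<^sup>2)"
    proof -
      have *: "(M l j)\<^sup>2 = M l j * z l + \<delta> * (z l * ap z l) + (\<delta> * ap z l)\<^sup>2" for l
      proof -
        have "M l j = z l + \<delta> * ap z l" using z[of l] by simp
        then show ?thesis by (simp add: power2_eq_square algebra_simps)
      qed
      have "0 \<le> \<delta> * (\<Sum>l\<in>B. z l * ap z l) + (\<Sum>l\<in>B. (\<delta> * ap z l)\<^sup>2)"
        using assms by (simp add: quad sum_nonneg)
      then show ?thesis by (simp add: * sum.distrib sum_distrib_left)
    qed
    moreover have "z j = M j j - \<delta> * (\<Sum>l\<in>B. M l j * z l)"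
      using z[of j] by (simp add: ap_def M_sym)
    moreover have "(\<Sum>i\<in>A. w i j * b i j) = z j"
      unfolding b_def z_def ap_eq ..
    ultimately show ?thesis
      using mult_left_mono[of "\<Sum>l\<in>B. M l j * z l" "\<Sum>l\<in>B. (M l j)\<^sup>2" \<delta>] assms
      by (simp add: M_def power2_eq_square)
  qed
  ultimately show ?thesis by blast
qed

section \<open>Second moments of random signs\<close>

text \<open>Adding \<open>a\<close> pairs the subsets of \<open>P\<close>, and paired terms cancel.
  Sums over \<open>Pow P\<close> play the role of expectations over a uniformly random
  subset.\<close>

lemma sum_Pow_eq_0:
  fixes g :: "'a set \<Rightarrow> real"
  assumes "finite P" "a \<in> P" "\<And>S. S \<subseteq> P - {a} \<Longrightarrow> g (insert a S) = - g S"
  shows "(\<Sum>S\<in>Pow P. g S) = 0"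
proof -
  have P: "Pow P = Pow (P - {a}) \<union> insert a ` Pow (P - {a})"
    using Pow_insert[of a "P - {a}"] assms(2) by (simp add: insert_absorb)
  have inj: "inj_on (insert a) (Pow (P - {a}))" by (auto simp: inj_on_def)
  have "(\<Sum>S\<in>Pow P. g S) = (\<Sum>S\<in>Pow (P - {a}). g S) + (\<Sum>S\<in>insert a ` Pow (P - {a}). g S)"
    unfolding P using assms(1) by (intro sum.union_disjoint) auto
  also have "(\<Sum>S\<in>insert a ` Pow (P - {a}). g S) = (\<Sum>S\<in>Pow (P - {a}). - g S)"
    unfolding sum.reindex[OF inj] o_def by (rule sum.cong) (auto simp: assms(3))
  finally show ?thesis by (simp add: sum_negf)
qed

text \<open>For \<open>S\<close> uniform in \<open>Pow P\<close> these are independent symmetric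
  signs; expectations appear unnormalized, multiplied by \<open>2 ^ card P\<close>.\<close>

definition sign_of :: "'a set \<Rightarrow> 'a \<Rightarrow> real" where
  "sign_of S p = (if p \<in> S then -1 else 1)"

lemma sign_of_squared [simp]: "sign_of S p * sign_of S p = 1"
  by (simp add: sign_of_def)

text \<open>Orthogonality of sign products: in the product belonging to two different indices the
  sign at \<open>a i\<close> occurs exactly once, so its sum over \<open>S\<close> vanishes and only
  the squares survive the expansion.\<close>

lemma sum_signs_squared:
  fixes c :: "'i \<Rightarrow> real"
  assumes "finite P" "finite I" "\<And>i. i \<in> I \<Longrightarrow> a i \<in> P" "\<And>i. i \<in> I \<Longrightarrow> a i \<noteq> b i"
    "\<And>i k. i \<in> I \<Longrightarrow> k \<in> I \<Longrightarrow> i \<noteq> k \<Longrightarrow> a i \<noteq> a k \<and> a i \<noteq> b k"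
  shows "(\<Sum>S\<in>Pow P. (\<Sum>i\<in>I. sign_of S (a i) * sign_of S (b i) * c i)\<^sup>2) = 2 ^ card P * (\<Sum>i\<in>I. (c i)\<^sup>2)"
proof -
  define h where "h S i = sign_of S (a i) * sign_of S (b i)" for S i
  have off: "(\<Sum>S\<in>Pow P. h S i * h S k) = (if i = k then 2 ^ card P else 0)" if "i \<in> I" "k \<in> I" for i k
  proof (cases "i = k")
    case True
    then show ?thesis using assms(1) by (simp add: h_def mult.assoc mult.left_commute[of "sign_of _ (b _)"] card_Pow)
  next
    case False
    then have a_ne: "b i \<noteq> a i" "a k \<noteq> a i" "b k \<noteq> a i"
      using assms(4)[of i] assms(5)[of i k] that by metis+
    have "(\<Sum>S\<in>Pow P. h S i * h S k) = 0"
      by (rule sum_Pow_eq_0[of _ "a i"])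
        (use assms(1,3) that a_ne in \<open>auto simp: h_def sign_of_def\<close>)
    then show ?thesis using False by simp
  qed
  have "(\<Sum>S\<in>Pow P. (\<Sum>i\<in>I. h S i * c i)\<^sup>2)
      = (\<Sum>S\<in>Pow P. \<Sum>i\<in>I. \<Sum>k\<in>I. c i * c k * (h S i * h S k))"
    unfolding power2_eq_square sum_product by (simp add: mult_ac)
  also have "\<dots> = (\<Sum>i\<in>I. \<Sum>k\<in>I. c i * c k * (\<Sum>S\<in>Pow P. h S i * h S k))"
    unfolding sum_distrib_left
    by (subst sum.swap, rule sum.cong[OF refl], rule sum.swap)
  also have "\<dots> = (\<Sum>i\<in>I. \<Sum>k\<in>I. if i = k then (c i)\<^sup>2 * 2 ^ card P else 0)"
    by (intro sum.cong refl) (simp add: off power2_eq_square)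
  also have "\<dots> = 2 ^ card P * (\<Sum>i\<in>I. (c i)\<^sup>2)"
    using assms(2) by (simp add: sum_distrib_left mult.commute)
  finally show ?thesis by (simp add: h_def)
qed

text \<open>
  Columns of degree below \<open>D / 2\<close> are dropped, which loses at most half of the edges. The random
  matrix \<open>w\<close> has entries \<open>\<plusminus>1 / \<surd>d\<^sub>j\<close>, so that its columns have norm 1 and its rows norm at most \<open>\<surd>2\<close>;
  \<open>Q\<close> is the error of the regularization with \<open>\<delta> = 1/6\<close>, weighted by the degrees \<open>d\<^sub>j\<close>.
\<close>

lemma block_of_row_choice:
  fixes N :: "nat \<Rightarrow> nat set"
  assumes fin: "finite A" "finite B" and ne: "A \<noteq> {}" and le: "card B \<le> card A" and D: "0 < D"
    and N: "\<And>i. i \<in> A \<Longrightarrow> N i \<subseteq> B \<and> card (N i) = D"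
  shows "\<exists>(s :: nat \<Rightarrow> nat \<Rightarrow> real) (b :: nat \<Rightarrow> nat \<Rightarrow> real) (x :: nat \<Rightarrow> real).
    (\<forall>i j. \<bar>s i j\<bar> \<le> 1) \<and> (\<forall>i j. s i j \<noteq> 0 \<longrightarrow> i \<in> A \<and> j \<in> N i) \<and>
    (\<forall>z. (\<Sum>i\<in>A. (\<Sum>j\<in>B. b i j * z j)\<^sup>2) \<le> 3 * (\<Sum>j\<in>B. (z j)\<^sup>2)) \<and>
    0 < (\<Sum>j\<in>B. (x j)\<^sup>2) \<and>
    D * (\<Sum>j\<in>B. (x j)\<^sup>2) * card A \<le> 8 * (\<Sum>i\<in>A. \<Sum>j\<in>B. s i j * b i j * x j)\<^sup>2"
proof -
  define d where "d j = card {i \<in> A. j \<in> N i}" for j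
  define B' where "B' = {j \<in> B. D \<le> 2 * d j}"
  define E where "E i j \<longleftrightarrow> i \<in> A \<and> j \<in> N i \<and> j \<in> B'" for i j
  define k where "k = (\<Sum>j\<in>B'. real (d j))"
  have B': "finite B'" "B' \<subseteq> B" using fin by (auto simp: B'_def)
  have dpos: "0 < d j" if "j \<in> B'" for j using that D by (auto simp: B'_def)
  have d_sum: "(\<Sum>i\<in>A. if E i j then c else 0) = real (d j) * c" if "j \<in> B'" for j c
  proof -
    have "{i \<in> A. E i j} = {i \<in> A. j \<in> N i}" using that by (auto simp: E_def)
    then show ?thesis
      using fin by (simp add: sum.If_cases Int_def d_def)
  qed
  \<comment> \<open>\<open>k\<close> counts the edges that are kept. Of the
    \<open>D * card A\<close> edges in all, the dropped columns, at most
    \<open>card B \<le> card A\<close> in number, carry fewer than \<open>D / 2\<close>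
    each.\<close>
  have k_ge: "real D * card A \<le> 2 * k"
  proof -
    have "real D * card A = (\<Sum>i\<in>A. real (card (N i)))" using N by simp
    also have "\<dots> = (\<Sum>i\<in>A. \<Sum>j\<in>B. if j \<in> N i then 1 else 0)"
    proof (rule sum.cong)
      fix i assume "i \<in> A"
      then have "B \<inter> N i = N i" using N by blast
      then show "real (card (N i)) = (\<Sum>j\<in>B. if j \<in> N i then 1 else 0)"
        using fin by (simp add: sum.If_cases)
    qed simp
    also have "\<dots> = (\<Sum>j\<in>B. real (d j))"
      using fin by (subst sum.swap) (simp add: sum.If_cases d_def Int_def)
    also have "\<dots> = k + (\<Sum>j\<in>B - B'. real (d j))"
      unfolding k_def using B' fin by (simp add: sum.subset_diff add.commute)
    also have "(\<Sum>j\<in>B - B'. real (d j)) \<le> (\<Sum>j\<in>B - B'. real D / 2)"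
      by (rule sum_mono) (auto simp: B'_def)
    also have "\<dots> \<le> real (card A) * (real D / 2)"
      using le fin by (simp add: mult_right_mono card_Diff_subset[OF B'])
    finally show ?thesis by (simp add: field_simps)
  qed
  have "0 < card A" using fin ne by (simp add: card_gt_0_iff)
  with k_ge D have kpos: "0 < k" by (smt (verit) mult_pos_pos of_nat_0_less_iff)
  define u where "u i j = (if E i j then 1 / sqrt (d j) else 0)" for i j
  have u_sq: "(u i j)\<^sup>2 = (if E i j then 1 / d j else 0)" for i j
    by (simp add: u_def power_divide)
  have u_col: "(\<Sum>i\<in>A. (u i j)\<^sup>2) = 1" if "j \<in> B'" for j
    using d_sum[OF that, of "1 / d j"] dpos[OF that] by (simp add: u_sq)
  \<comment> \<open>Row \<open>i\<close> has at most \<open>D\<close> nonzero entries, with squares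
    \<open>1 / d j \<le> 2 / D\<close>.\<close>
  have u_row: "(\<Sum>j\<in>B'. (u i j)\<^sup>2) \<le> 2" if "i \<in> A" for i
  proof -
    have "(\<Sum>j\<in>B'. (u i j)\<^sup>2) = (\<Sum>j\<in>B' \<inter> N i. 1 / d j)"
      unfolding u_sq using B' that by (simp add: sum.If_cases E_def Int_def conj_commute cong: conj_cong)
    also have "\<dots> \<le> (\<Sum>j\<in>B' \<inter> N i. 2 / D)"
    proof (rule sum_mono)
      fix j assume "j \<in> B' \<inter> N i"
      then have "real D \<le> 2 * real (d j)" "0 < d j" using dpos by (auto simp: B'_def)
      then show "1 / real (d j) \<le> 2 / real D" using D by (simp add: field_simps)
    qed
    also have "\<dots> = real (card (B' \<inter> N i)) * (2 / D)" by simp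
    also have "\<dots> \<le> real D * (2 / D)"
    proof (rule mult_right_mono)
      have "finite (N i)" using N[OF that] fin finite_subset by blast
      then show "real (card (B' \<inter> N i)) \<le> real D"
        using N[OF that] by (metis card_mono inf_le2 of_nat_mono)
    qed simp
    finally show ?thesis using D by simp
  qed
  define P where "P = A \<times> B"
  define w where "w S i j = sign_of S (i, j) * u i j" for S i j
  define Q where "Q S = (\<Sum>j\<in>B'. real (d j) * (\<Sum>l\<in>B'. (\<Sum>i\<in>A. w S i l * w S i j)\<^sup>2))" for S
  \<comment> \<open>The 3 is 1 + 2: in column \<open>j\<close> the term \<open>l = j\<close>
    contributes 1; the other second moments add up to squared row norms, at most 2, averaged against
    a unit column.\<close>
  have "(\<Sum>S\<in>Pow P. Q S) \<le> (\<Sum>S\<in>Pow P. 3 * k)"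
  proof -
    have second_moment: "(\<Sum>S\<in>Pow P. (\<Sum>i\<in>A. w S i l * w S i j)\<^sup>2)
        \<le> 2 ^ card P * ((if l = j then 1 else 0) + (\<Sum>i\<in>A. (u i l)\<^sup>2 * (u i j)\<^sup>2))"
      if "j \<in> B'" "l \<in> B'" for j l
    proof (cases "l = j")
      case True
      then have "(\<Sum>i\<in>A. w S i l * w S i j) = 1" for S
        using u_col[OF that(1)] by (simp add: w_def power2_eq_square mult_ac)
      then show ?thesis using True fin by (simp add: card_Pow P_def sum_nonneg)
    next
      case False
      have "(\<Sum>S\<in>Pow P. (\<Sum>i\<in>A. w S i l * w S i j)\<^sup>2)
         = (\<Sum>S\<in>Pow P. (\<Sum>i\<in>A. sign_of S (i, l) * sign_of S (i, j) * (u i l * u i j))\<^sup>2)"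
        by (simp add: w_def mult_ac)
      also have "\<dots> = 2 ^ card P * (\<Sum>i\<in>A. (u i l * u i j)\<^sup>2)"
        by (rule sum_signs_squared) (use fin that B' False in \<open>auto simp: P_def\<close>)
      finally show ?thesis using False by (simp add: power_mult_distrib)
    qed
    have "(\<Sum>S\<in>Pow P. Q S)
        = (\<Sum>j\<in>B'. real (d j) * (\<Sum>l\<in>B'. \<Sum>S\<in>Pow P. (\<Sum>i\<in>A. w S i l * w S i j)\<^sup>2))"
    proof -
      have "(\<Sum>S\<in>Pow P. Q S)
          = (\<Sum>j\<in>B'. real (d j) * (\<Sum>S\<in>Pow P. \<Sum>l\<in>B'. (\<Sum>i\<in>A. w S i l * w S i j)\<^sup>2))"
        unfolding Q_def by (subst sum.swap) (simp only: sum_distrib_left[symmetric])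
      also have "\<dots> = (\<Sum>j\<in>B'. real (d j) * (\<Sum>l\<in>B'. \<Sum>S\<in>Pow P. (\<Sum>i\<in>A. w S i l * w S i j)\<^sup>2))"
        by (rule sum.cong[OF refl], rule arg_cong[of _ _ "(*) _"], rule sum.swap)
      finally show ?thesis .
    qed
    also have "\<dots> \<le> (\<Sum>j\<in>B'. real (d j) * (\<Sum>l\<in>B'.
        2 ^ card P * ((if l = j then 1 else 0) + (\<Sum>i\<in>A. (u i l)\<^sup>2 * (u i j)\<^sup>2))))"
      by (intro sum_mono mult_left_mono second_moment) auto
    also have "\<dots> = 2 ^ card P * (\<Sum>j\<in>B'. real (d j) * (1 + (\<Sum>i\<in>A. (\<Sum>l\<in>B'. (u i l)\<^sup>2) * (u i j)\<^sup>2)))"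
    proof -
      have "(\<Sum>l\<in>B'. (if l = j then 1 else 0) + (\<Sum>i\<in>A. (u i l)\<^sup>2 * (u i j)\<^sup>2))
          = 1 + (\<Sum>i\<in>A. (\<Sum>l\<in>B'. (u i l)\<^sup>2) * (u i j)\<^sup>2)" if "j \<in> B'" for j
        using B' that unfolding sum_distrib_right sum.distrib by (subst (2) sum.swap) simp
      then have "(\<Sum>j\<in>B'. real (d j) * (\<Sum>l\<in>B'.
          2 ^ card P * ((if l = j then 1 else 0) + (\<Sum>i\<in>A. (u i l)\<^sup>2 * (u i j)\<^sup>2))))
        = (\<Sum>j\<in>B'. real (d j) * (2 ^ card P * (1 + (\<Sum>i\<in>A. (\<Sum>l\<in>B'. (u i l)\<^sup>2) * (u i j)\<^sup>2))))"
        unfolding sum_distrib_left[symmetric] by (intro sum.cong refl) simp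
      then show ?thesis
        by (simp only: sum_distrib_left mult.left_commute)
    qed
    also have "\<dots> \<le> 2 ^ card P * (\<Sum>j\<in>B'. real (d j) * (1 + (\<Sum>i\<in>A. 2 * (u i j)\<^sup>2)))"
      by (intro mult_left_mono sum_mono add_left_mono mult_right_mono u_row) auto
    also have "\<dots> = 2 ^ card P * (\<Sum>j\<in>B'. real (d j) * 3)"
    proof -
      have "1 + (\<Sum>i\<in>A. 2 * (u i j)\<^sup>2) = 3" if "j \<in> B'" for j
        unfolding sum_distrib_left[symmetric] u_col[OF that] by simp
      then show ?thesis by (simp cong: sum.cong)
    qed
    also have "\<dots> = (\<Sum>S\<in>Pow P. 3 * k)"
      using fin by (simp add: card_Pow P_def k_def sum_distrib_right[symmetric])
    finally show ?thesis .
  qed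
  moreover have "(\<Sum>S\<in>Pow P. 3 * k) < (\<Sum>S\<in>Pow P. Q S)" if "\<And>S. 3 * k < Q S"
    using fin that by (intro sum_strict_mono) (auto simp: P_def)
  ultimately obtain S where S: "Q S \<le> 3 * k"
    by (meson not_less)
  \<comment> \<open>With delta = 1/6 the bound 1 / (2 delta) on the squared norm is 3, and the loss
    \<open>Q S / 6 \<le> k / 2\<close> leaves half of the main term \<open>k\<close>.\<close>
  obtain b where b1: "\<And>z. 2 * (1 / 6) * (\<Sum>i\<in>A. (\<Sum>j\<in>B'. b i j * z j)\<^sup>2) \<le> (\<Sum>j\<in>B'. (z j)\<^sup>2)"
    and b2: "\<And>j. j \<in> B' \<Longrightarrow> (\<Sum>i\<in>A. (w S i j)\<^sup>2) - 1 / 6 * (\<Sum>l\<in>B'. (\<Sum>i\<in>A. w S i l * w S i j)\<^sup>2)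
        \<le> (\<Sum>i\<in>A. w S i j * b i j)"
    using regularized_matrix[of A B' "1 / 6" "w S"] fin B' by auto
  define s where "s i j = (if E i j then sign_of S (i, j) else 0)" for i j
  define b' where "b' i j = (if j \<in> B' then b i j else 0)" for i j
  \<comment> \<open>The entries \<open>sqrt (d j)\<close> undo the normalization of
    \<open>w\<close>: on \<open>B'\<close>, \<open>d j * w S i j = s i j * sqrt (d j)\<close>. The
    tested sum is thus the trace of W*b weighted by the degrees.\<close>
  define x where "x j = (if j \<in> B' then sqrt (d j) else 0)" for j
  have restrict: "(\<Sum>j\<in>B. if j \<in> B' then f j else 0) = (\<Sum>j\<in>B'. f j)" for f :: "nat \<Rightarrow> real"
    using fin B' by (simp add: sum.If_cases Int_absorb1)
  have x_sq: "(\<Sum>j\<in>B. (x j)\<^sup>2) = k"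
    unfolding k_def restrict[symmetric] by (rule sum.cong) (auto simp: x_def)
  have "(\<Sum>i\<in>A. (\<Sum>j\<in>B. b' i j * z j)\<^sup>2) \<le> 3 * (\<Sum>j\<in>B. (z j)\<^sup>2)" for z
  proof -
    have "(\<Sum>j\<in>B. b' i j * z j) = (\<Sum>j\<in>B'. b i j * z j)" for i
      unfolding restrict[symmetric] by (rule sum.cong) (auto simp: b'_def)
    moreover have "(\<Sum>j\<in>B'. (z j)\<^sup>2) \<le> (\<Sum>j\<in>B. (z j)\<^sup>2)"
      using fin B' by (intro sum_mono2) auto
    ultimately show ?thesis using b1[of z] by simp
  qed
  moreover have "real D * (\<Sum>j\<in>B. (x j)\<^sup>2) * card A \<le> 8 * (\<Sum>i\<in>A. \<Sum>j\<in>B. s i j * b' i j * x j)\<^sup>2"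
  proof -
    let ?t = "\<Sum>i\<in>A. \<Sum>j\<in>B. s i j * b' i j * x j"
    have w_sq: "(\<Sum>i\<in>A. (w S i j)\<^sup>2) = 1" if "j \<in> B'" for j
    proof -
      have "(w S i j)\<^sup>2 = (u i j)\<^sup>2" for i by (simp add: w_def sign_of_def)
      then show ?thesis using u_col[OF that] by simp
    qed
    have "k - 1 / 6 * Q S = (\<Sum>j\<in>B'. d j - 1 / 6 * (d j * (\<Sum>l\<in>B'. (\<Sum>i\<in>A. w S i l * w S i j)\<^sup>2)))"
      unfolding k_def Q_def sum_subtractf sum_distrib_left[symmetric] ..
    also have "\<dots>
        = (\<Sum>j\<in>B'. d j * ((\<Sum>i\<in>A. (w S i j)\<^sup>2) - 1 / 6 * (\<Sum>l\<in>B'. (\<Sum>i\<in>A. w S i l * w S i j)\<^sup>2)))"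
      by (rule sum.cong) (simp_all add: w_sq right_diff_distrib)
    also have "\<dots> \<le> (\<Sum>j\<in>B'. d j * (\<Sum>i\<in>A. w S i j * b i j))"
      by (intro sum_mono mult_left_mono b2) auto
    also have "\<dots> = (\<Sum>j\<in>B'. \<Sum>i\<in>A. s i j * b i j * sqrt (d j))"
    proof -
      have "real (d j) * (w S i j * b i j) = s i j * b i j * sqrt (d j)" if "j \<in> B'" for i j
      proof -
        have "real (d j) * u i j = (if E i j then sqrt (d j) else 0)"
          using dpos[OF that] by (simp add: u_def real_div_sqrt)
        moreover have "real (d j) * (w S i j * b i j) = sign_of S (i, j) * b i j * (real (d j) * u i j)"
          by (simp add: w_def)
        ultimately have "real (d j) * (w S i j * b i j)
            = sign_of S (i, j) * b i j * (if E i j then sqrt (d j) else 0)" by (simp only:)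
        then show ?thesis
          by (cases "E i j") (simp_all only: s_def if_True if_False mult_zero_right mult_zero_left)
      qed
      then have "(\<Sum>i\<in>A. real (d j) * (w S i j * b i j)) = (\<Sum>i\<in>A. s i j * b i j * sqrt (d j))"
        if "j \<in> B'" for j using that by (simp only: cong: sum.cong)
      then show ?thesis
        unfolding sum_distrib_left by (rule sum.cong[OF refl])
    qed
    also have "\<dots> = (\<Sum>i\<in>A. \<Sum>j\<in>B'. s i j * b i j * sqrt (d j))"
      by (rule sum.swap)
    also have "\<dots> = ?t"
      unfolding restrict[symmetric] by (intro sum.cong) (auto simp: x_def b'_def)
    finally have "k / 2 \<le> ?t" using S by simp
    \<comment> \<open>Origin of the constant 8: the estimate by \<open>k / 2\<close> costs a factor
      4 after squaring, and \<open>D * card A \<le> 2 * k\<close> costs a factor 2.\<close>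
    then have "k\<^sup>2 / 4 \<le> ?t\<^sup>2" using power_mono[of "k / 2" ?t 2] kpos by (simp add: power_divide)
    moreover have "k * (real D * card A) \<le> 2 * k\<^sup>2"
      using mult_left_mono[OF k_ge, of k] kpos by (simp add: power2_eq_square)
    ultimately have "k * (real D * card A) \<le> 8 * ?t\<^sup>2" by linarith
    then show ?thesis unfolding x_sq by (simp only: mult.left_commute mult.assoc)
  qed
  moreover have "\<bar>s i j\<bar> \<le> 1" "s i j \<noteq> 0 \<longrightarrow> i \<in> A \<and> j \<in> N i" for i j
    by (auto simp: s_def sign_of_def E_def)
  moreover have "0 < (\<Sum>j\<in>B. (x j)\<^sup>2)" using x_sq kpos by simp
  ultimately show ?thesis by (intro exI[of _ s] exI[of _ b'] exI[of _ x] conjI allI)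
qed

section \<open>Blocks on rectangles with large degrees\<close>

text \<open>The third clause says that \<open>b\<close> has operator norm at most sqrt 3; the test
  vectors \<open>x\<close> and \<open>y\<close> witness that the Schur product of \<open>s\<close>
  and \<open>b\<close> has norm at least sqrt (D/8). The last inequality avoids division; positivity
  of the two sums allows them to be cancelled later.\<close>

definition sign_block :: "(nat \<times> nat) set \<Rightarrow> nat \<Rightarrow> nat set \<Rightarrow> nat set \<Rightarrow>
    (nat \<Rightarrow> nat \<Rightarrow> real) \<Rightarrow> (nat \<Rightarrow> nat \<Rightarrow> real) \<Rightarrow> (nat \<Rightarrow> real) \<Rightarrow> (nat \<Rightarrow> real) \<Rightarrow> bool" where
  "sign_block \<kappa> D A B s b x y \<longleftrightarrow>
    (\<forall>i j. \<bar>s i j\<bar> \<le> 1) \<and>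
    (\<forall>i j. s i j \<noteq> 0 \<longrightarrow> i \<in> A \<and> j \<in> B \<and> (i, j) \<in> \<kappa>) \<and>
    (\<forall>z. (\<Sum>i\<in>A. (\<Sum>j\<in>B. b i j * z j)\<^sup>2) \<le> 3 * (\<Sum>j\<in>B. (z j)\<^sup>2)) \<and>
    0 < (\<Sum>j\<in>B. (x j)\<^sup>2) \<and> 0 < (\<Sum>i\<in>A. (y i)\<^sup>2) \<and>
    D * ((\<Sum>j\<in>B. (x j)\<^sup>2) * (\<Sum>i\<in>A. (y i)\<^sup>2))
      \<le> 8 * (\<Sum>i\<in>A. \<Sum>j\<in>B. s i j * b i j * x j * y i)\<^sup>2"

text \<open>A matrix and its transpose have the same norm. For z the transpose applied to y, |z|^2 =
  <y, b z>, so Cauchy-Schwarz and the hypothesis give |z|^4 \<le> c |y|^2 |z|^2.\<close>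

lemma transpose_bound:
  fixes b :: "'i \<Rightarrow> 'j \<Rightarrow> real"
  assumes "\<And>z. (\<Sum>i\<in>A. (\<Sum>j\<in>B. b i j * z j)\<^sup>2) \<le> c * (\<Sum>j\<in>B. (z j)\<^sup>2)" "0 \<le> c"
  shows "(\<Sum>j\<in>B. (\<Sum>i\<in>A. b i j * y i)\<^sup>2) \<le> c * (\<Sum>i\<in>A. (y i)\<^sup>2)"
proof -
  define z where "z j = (\<Sum>i\<in>A. b i j * y i)" for j
  define Z where "Z = (\<Sum>j\<in>B. (z j)\<^sup>2)"
  have "Z = (\<Sum>j\<in>B. \<Sum>i\<in>A. y i * (b i j * z j))"
    unfolding Z_def power2_eq_square by (subst (2) z_def) (simp add: sum_distrib_left mult_ac)
  also have "\<dots> = (\<Sum>i\<in>A. y i * (\<Sum>j\<in>B. b i j * z j))"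
    by (subst sum.swap) (simp add: sum_distrib_left)
  finally have "Z\<^sup>2 \<le> (\<Sum>i\<in>A. (y i)\<^sup>2) * (\<Sum>i\<in>A. (\<Sum>j\<in>B. b i j * z j)\<^sup>2)"
    by (simp only: Cauchy_Schwarz_ineq_sum)
  also have "\<dots> \<le> (\<Sum>i\<in>A. (y i)\<^sup>2) * (c * Z)"
    unfolding Z_def by (intro mult_left_mono assms sum_nonneg) auto
  finally have *: "Z * Z \<le> (c * (\<Sum>i\<in>A. (y i)\<^sup>2)) * Z" by (simp add: power2_eq_square mult_ac)
  have "0 \<le> Z" by (simp add: Z_def sum_nonneg)
  then have "Z \<le> c * (\<Sum>i\<in>A. (y i)\<^sup>2)"
    using * assms(2) by (cases "Z = 0") (auto simp: sum_nonneg)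
  then show ?thesis by (simp add: Z_def z_def)
qed

text \<open>Each row keeps exactly \<open>D\<close> of its points, so that the row construction
  applies; the second test vector is constantly 1, with squared norm \<open>card A\<close>.\<close>

lemma sign_block_exists_le:
  assumes "finite A" "finite B" "A \<noteq> {}" "card B \<le> card A" "0 < D"
    and deg: "\<And>i. i \<in> A \<Longrightarrow> D \<le> card {j \<in> B. (i, j) \<in> \<kappa>}"
  shows "\<exists>s b x y. sign_block \<kappa> D A B s b x y"
proof -
  have "\<exists>N. N \<subseteq> {j \<in> B. (i, j) \<in> \<kappa>} \<and> card N = D" if "i \<in> A" for i
    using obtain_subset_with_card_n[OF deg[OF that]] by blast
  then obtain N where N: "\<And>i. i \<in> A \<Longrightarrow> N i \<subseteq> {j \<in> B. (i, j) \<in> \<kappa>} \<and> card (N i) = D"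
    by metis
  then have sub: "\<And>i. i \<in> A \<Longrightarrow> N i \<subseteq> B \<and> card (N i) = D" by blast
  obtain s b :: "nat \<Rightarrow> nat \<Rightarrow> real" and x :: "nat \<Rightarrow> real"
    where *: "\<forall>i j. \<bar>s i j\<bar> \<le> 1" "\<forall>i j. s i j \<noteq> 0 \<longrightarrow> i \<in> A \<and> j \<in> N i"
    "\<forall>z. (\<Sum>i\<in>A. (\<Sum>j\<in>B. b i j * z j)\<^sup>2) \<le> 3 * (\<Sum>j\<in>B. (z j)\<^sup>2)"
    "0 < (\<Sum>j\<in>B. (x j)\<^sup>2)"
    "D * (\<Sum>j\<in>B. (x j)\<^sup>2) * card A \<le> 8 * (\<Sum>i\<in>A. \<Sum>j\<in>B. s i j * b i j * x j)\<^sup>2"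
    using block_of_row_choice[of A B D N, OF assms(1-5) sub] by blast
  have "0 < card A" using assms by (simp add: card_gt_0_iff)
  with * N have "sign_block \<kappa> D A B s b x (\<lambda>_. 1)"
    unfolding sign_block_def by (simp add: mult.assoc) blast
  then show ?thesis by blast
qed

lemma sign_block_transpose:
  assumes "sign_block {(j, i). (i, j) \<in> \<kappa>} D B A s b x y"
  shows "sign_block \<kappa> D A B (\<lambda>i j. s j i) (\<lambda>i j. b j i) y x"
proof -
  have "(\<Sum>i\<in>A. (\<Sum>j\<in>B. b j i * z j)\<^sup>2) \<le> 3 * (\<Sum>j\<in>B. (z j)\<^sup>2)" for z
  proof (rule transpose_bound)
    show "(\<Sum>i\<in>B. (\<Sum>j\<in>A. b i j * v j)\<^sup>2) \<le> 3 * (\<Sum>j\<in>A. (v j)\<^sup>2)" for v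
      using assms by (simp only: sign_block_def)
  qed simp
  moreover have "(\<Sum>i\<in>A. \<Sum>j\<in>B. s j i * b j i * y j * x i) = (\<Sum>j\<in>B. \<Sum>i\<in>A. s j i * b j i * x i * y j)"
    by (subst sum.swap) (simp add: mult_ac)
  moreover have "(\<Sum>j\<in>B. (y j)\<^sup>2) * (\<Sum>i\<in>A. (x i)\<^sup>2) = (\<Sum>i\<in>A. (x i)\<^sup>2) * (\<Sum>j\<in>B. (y j)\<^sup>2)"
    by (rule mult.commute)
  ultimately show ?thesis
    using assms unfolding sign_block_def by (simp only: mem_Collect_eq prod.case) blast
qed

text \<open>The row construction wants at least as many rows as columns. A wider rectangle is
  transposed, and its column degrees then take over from the row degrees.\<close>

lemma sign_block_exists:
  assumes "finite A" "finite B" "A \<noteq> {}" "B \<noteq> {}" "0 < D"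
    and "\<And>i. i \<in> A \<Longrightarrow> D \<le> card {j \<in> B. (i, j) \<in> \<kappa>}"
    and "\<And>j. j \<in> B \<Longrightarrow> D \<le> card {i \<in> A. (i, j) \<in> \<kappa>}"
  shows "\<exists>s b x y. sign_block \<kappa> D A B s b x y"
proof (cases "card B \<le> card A")
  case True
  then show ?thesis using assms sign_block_exists_le by blast
next
  case False
  then have "\<exists>s b x y. sign_block {(j, i). (i, j) \<in> \<kappa>} D B A s b x y"
    using assms by (intro sign_block_exists_le) auto
  then show ?thesis using sign_block_transpose by blast
qed

section \<open>Direct sum of blocks along disjoint intervals\<close>

text \<open>The bound on initial segments makes the rowwise formula square-summable, so that
  \<open>Abs_ell2\<close> is faithful on it, and bounds the norm by \<open>sqrt K\<close>.\<close>

lemma row_finite_op: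
  fixes t :: "nat \<Rightarrow> nat \<Rightarrow> complex"
  assumes bound: "\<And>x n. (\<Sum>i<n. (cmod (\<Sum>j\<in>J i. t i j * coord x j))\<^sup>2) \<le> K * (norm x)\<^sup>2" and "0 \<le> K"
  shows "\<exists>T\<in>BH. \<forall>x i. coord (blinfun_apply T x) i = (\<Sum>j\<in>J i. t i j * coord x j)"
proof -
  define F where "F x = Abs_ell2 (\<lambda>i. \<Sum>j\<in>J i. t i j * coord x j)" for x
  have sm: "summable (\<lambda>i. (cmod (\<Sum>j\<in>J i. t i j * coord x j))\<^sup>2)" for x
    by (rule summableI_nonneg_bounded[OF _ bound]) simp
  then have coord_F: "coord (F x) i = (\<Sum>j\<in>J i. t i j * coord x j)" for x i
    by (simp add: F_def Abs_ell2_inverse)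
  have "bounded_linear F"
  proof (rule bounded_linear_intro)
    show "F (x + y) = F x + F y" for x y
      by (rule ell2_eqI) (simp add: coord_F algebra_simps sum.distrib)
    show "F (r *\<^sub>R x) = r *\<^sub>R F x" for r x
      by (rule ell2_eqI) (simp add: coord_F sum_distrib_left mult_ac)
    show "norm (F x) \<le> norm x * sqrt K" for x
    proof -
      have "(norm (F x))\<^sup>2 \<le> K * (norm x)\<^sup>2"
        unfolding norm_ell2_squared[of "F x"] coord_F by (rule suminf_le_const[OF sm bound])
      then have "norm (F x) \<le> sqrt (K * (norm x)\<^sup>2)" by (rule real_le_rsqrt)
      then show ?thesis by (simp add: real_sqrt_mult mult.commute)
    qed
  qed
  then have ap: "blinfun_apply (Blinfun F) = F" by (rule bounded_linear_Blinfun_apply)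
  have "Blinfun F \<in> BH"
    unfolding BH_def by (auto intro!: ell2_eqI simp: ap coord_F sum_distrib_left mult_ac)
  then show ?thesis using coord_F ap by force
qed

lemma cmod_sum_real_squared:
  "(cmod (\<Sum>j\<in>B. complex_of_real (b j) * z j))\<^sup>2 = (\<Sum>j\<in>B. b j * Re (z j))\<^sup>2 + (\<Sum>j\<in>B. b j * Im (z j))\<^sup>2"
  unfolding cmod_power2 Re_sum Im_sum by simp

lemma inner_basis_vec_right: "x \<bullet> basis_vec i = Re (coord x i)"
proof -
  have "(\<Sum>k. coord x k \<bullet> coord (basis_vec i) k) = (\<Sum>k\<in>{i}. coord x k \<bullet> coord (basis_vec i) k)"
    by (rule suminf_finite) (auto simp: coord_basis_vec)
  then show ?thesis by (simp add: inner_ell2.rep_eq coord_basis_vec inner_complex_def)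
qed

lemma norm_sum_basis_squared:
  assumes "finite B"
  shows "(norm (\<Sum>j\<in>B. x j *\<^sub>R basis_vec j))\<^sup>2 = (\<Sum>j\<in>B. (x j)\<^sup>2)"
proof -
  have "(norm (\<Sum>j\<in>B. x j *\<^sub>R basis_vec j))\<^sup>2 = (\<Sum>i\<in>B. \<Sum>j\<in>B. if i = j then (x i)\<^sup>2 else 0)"
    unfolding power2_norm_eq_inner inner_sum_left inner_sum_right
    by (intro sum.cong refl) (simp add: inner_basis_vec power2_eq_square)
  then show ?thesis using assms by simp
qed

lemma inner_apply_sum_basis:
  "blinfun_apply S (\<Sum>j\<in>B. x j *\<^sub>R basis_vec j) \<bullet> (\<Sum>i\<in>A. y i *\<^sub>R basis_vec i)
    = (\<Sum>i\<in>A. \<Sum>j\<in>B. Re (entry S (i, j)) * x j * y i)"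
proof -
  have "blinfun_apply S (\<Sum>j\<in>B. x j *\<^sub>R basis_vec j) \<bullet> (y i *\<^sub>R basis_vec i)
      = (\<Sum>j\<in>B. Re (entry S (i, j)) * x j * y i)" for i
    by (simp add: blinfun.sum_right blinfun.scaleR_right inner_basis_vec_right entry_eq_coord
        sum_distrib_left mult_ac)
  then show ?thesis unfolding inner_sum_right by simp
qed

text \<open>Block number n lies beyond the earlier ones and is taken with \<open>D = n\<close>. The
  direct sum of the matrices stays bounded by sqrt 3, while its Schur product with a single bounded
  function supported on \<kappa> would need squared norm at least n/8 for every n.\<close>

lemma no_escaping_sign_blocks:
  assumes "schur_bounded_pattern \<kappa>"
    and blocks: "\<And>p D. \<exists>q A B s b x y. A \<subseteq> {p..<q} \<and> B \<subseteq> {p..<q} \<and> sign_block \<kappa> D A B s b x y"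
  shows False
proof -
  obtain qf Af Bf sf bf xf yf where f: "\<And>p D. Af p D \<subseteq> {p..<qf p D}" "\<And>p D. Bf p D \<subseteq> {p..<qf p D}"
    "\<And>p D. sign_block \<kappa> D (Af p D) (Bf p D) (sf p D) (bf p D) (xf p D) (yf p D)"
    using blocks by metis
  \<comment> \<open>\<open>p n\<close> is the left end of block \<open>n\<close>; that block stays
    below \<open>p (Suc n)\<close>, where the next one starts.\<close>
  define p where "p = rec_nat 0 (\<lambda>n r. qf r n)"
  have p_Suc: "p (Suc n) = qf (p n) n" for n by (simp add: p_def)
  define A B s b x y where "A n = Af (p n) n" and "B n = Bf (p n) n" and "s n = sf (p n) n"
    and "b n = bf (p n) n" and "x n = xf (p n) n" and "y n = yf (p n) n" for n
  have sub: "A n \<subseteq> {p n..<p (Suc n)}" "B n \<subseteq> {p n..<p (Suc n)}" for n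
    by (simp_all only: A_def B_def p_Suc f)
  then have fin: "finite (A n)" "finite (B n)" for n by (meson finite_atLeastLessThan finite_subset)+
  have block: "sign_block \<kappa> n (A n) (B n) (s n) (b n) (x n) (y n)" for n
    by (simp only: A_def B_def s_def b_def x_def y_def f)
  have block_bound: "(\<Sum>i\<in>A n. (\<Sum>j\<in>B n. b n i j * z j)\<^sup>2) \<le> 3 * (\<Sum>j\<in>B n. (z j)\<^sup>2)" for n z
    using block[of n] by (simp add: sign_block_def)
  have ne: "A n \<noteq> {}" for n using block[of n] by (auto simp: sign_block_def)
  have "p n < p (Suc n)" for n using sub(1)[of n] ne[of n] by fastforce
  then have "strict_mono p" by (simp add: strict_mono_Suc_iff)
  have disj: "m = n" if "i \<in> {p m..<p (Suc m)}" "i \<in> {p n..<p (Suc n)}" for i m n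
  proof (rule ccontr)
    assume "m \<noteq> n"
    then have "Suc m \<le> n \<or> Suc n \<le> m" by linarith
    then have "p (Suc m) \<le> p n \<or> p (Suc n) \<le> p m"
      using \<open>strict_mono p\<close> by (auto simp: strict_mono_less_eq)
    then show False using that by auto
  qed
  \<comment> \<open>The number of the block containing row \<open>i\<close>. It is arbitrary for a
    row in no block, but there \<open>J\<close> is empty and the row of the operator
    vanishes.\<close>
  define idx where "idx i = (THE n. i \<in> A n)" for i
  have idx: "idx i = n" if "i \<in> A n" for i n
    unfolding idx_def using that disj sub(1) by (intro the_equality) blast+
  define J where "J i = (if i \<in> (\<Union>n. A n) then B (idx i) else {})" for i
  have J: "J i = B n" if "i \<in> A n" for i n using that idx by (auto simp: J_def)
  define t where "t i j = complex_of_real (b (idx i) i j)" for i j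
  have "\<exists>T\<in>BH. \<forall>x i. coord (blinfun_apply T x) i = (\<Sum>j\<in>J i. t i j * coord x j)"
  proof (rule row_finite_op)
    fix v N
    define g where "g i = (cmod (\<Sum>j\<in>J i. t i j * coord v j))\<^sup>2" for i
    have one: "(\<Sum>i\<in>A n. g i) \<le> 3 * (\<Sum>j\<in>B n. (cmod (coord v j))\<^sup>2)" for n
    proof -
      \<comment> \<open>A real matrix acts separately on real and imaginary parts, so the real bound
        of a block carries over to complex vectors.\<close>
      have "(\<Sum>i\<in>A n. g i) = (\<Sum>i\<in>A n. (\<Sum>j\<in>B n. b n i j * Re (coord v j))\<^sup>2)
          + (\<Sum>i\<in>A n. (\<Sum>j\<in>B n. b n i j * Im (coord v j))\<^sup>2)"
        by (simp add: g_def J t_def idx cmod_sum_real_squared sum.distrib)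
      also have "\<dots> \<le> 3 * (\<Sum>j\<in>B n. (Re (coord v j))\<^sup>2) + 3 * (\<Sum>j\<in>B n. (Im (coord v j))\<^sup>2)"
        by (intro add_mono block_bound)
      also have "\<dots> = 3 * (\<Sum>j\<in>B n. (cmod (coord v j))\<^sup>2)"
        by (simp add: cmod_power2 sum.distrib)
      finally show ?thesis .
    qed
    have "(\<Sum>i<N. g i) = (\<Sum>i\<in>{..<N} \<inter> (\<Union>n. A n). g i)"
      by (rule sum.mono_neutral_right) (auto simp: g_def J_def)
    also have "\<dots> \<le> (\<Sum>i\<in>(\<Union>n<N. A n). g i)"
    proof (rule sum_mono2)
      \<comment> \<open>Since \<open>n \<le> p n\<close>, a row below \<open>N\<close> can only
        belong to one of the first \<open>N\<close> blocks.\<close>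
      show "{..<N} \<inter> (\<Union>n. A n) \<subseteq> (\<Union>n<N. A n)"
      proof
        fix i assume "i \<in> {..<N} \<inter> (\<Union>n. A n)"
        then obtain n where n: "i < N" "i \<in> A n" by auto
        then have "p n \<le> i" using sub(1) by fastforce
        then have "n < N" using n(1) strict_mono_imp_increasing[OF \<open>strict_mono p\<close>, of n] by linarith
        then show "i \<in> (\<Union>n<N. A n)" using n by blast
      qed
    qed (auto simp: fin g_def)
    also have "\<dots> = (\<Sum>n<N. \<Sum>i\<in>A n. g i)"
      by (rule sum.UNION_disjoint) (use fin disj sub(1) in blast)+
    also have "\<dots> \<le> (\<Sum>n<N. 3 * (\<Sum>j\<in>B n. (cmod (coord v j))\<^sup>2))"
      by (intro sum_mono one)
    also have "\<dots> = 3 * (\<Sum>j\<in>(\<Union>n<N. B n). (cmod (coord v j))\<^sup>2)"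
    proof -
      have "(\<Sum>j\<in>(\<Union>n<N. B n). (cmod (coord v j))\<^sup>2) = (\<Sum>n<N. \<Sum>j\<in>B n. (cmod (coord v j))\<^sup>2)"
        by (rule sum.UNION_disjoint) (use fin disj sub(2) in blast)+
      then show ?thesis by (simp add: sum_distrib_left)
    qed
    also have "\<dots> \<le> 3 * (norm v)\<^sup>2"
      using fin by (intro mult_left_mono sum_cmod_coord_le) auto
    finally show "(\<Sum>i<N. (cmod (\<Sum>j\<in>J i. t i j * coord v j))\<^sup>2) \<le> 3 * (norm v)\<^sup>2"
      by (simp only: g_def)
  qed simp
  then obtain T where T: "T \<in> BH" "\<And>x i. coord (blinfun_apply T x) i = (\<Sum>j\<in>J i. t i j * coord x j)"
    by blast
  have T_entry: "entry T (i, j) = b n i j" if "i \<in> A n" "j \<in> B n" for i j n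
    using that fin by (simp add: entry_eq_coord T J coord_basis_vec t_def idx if_distrib cong: if_cong)
  \<comment> \<open>The row alone selects the block: in columns outside it, \<open>s\<close>
    vanishes by its support condition.\<close>
  define \<phi> where "\<phi> = (\<lambda>(i, j). if i \<in> (\<Union>n. A n) then complex_of_real (s (idx i) i j) else 0)"
  have s: "\<bar>s n i j\<bar> \<le> 1" "s n i j \<noteq> 0 \<Longrightarrow> (i, j) \<in> \<kappa>" for n i j
    using block[of n] by (auto simp: sign_block_def)
  have "bounded (range \<phi>)"
    by (rule boundedI[of _ 1]) (auto simp: \<phi>_def s)
  moreover have "\<phi> pr = 0" if "pr \<notin> \<kappa>" for pr
    using s(2) that by (force simp: \<phi>_def split: prod.splits)
  ultimately have "schur_multiplier_function \<phi>"
    using assms(1) by (simp add: schur_bounded_pattern_def)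
  then obtain S where S: "is_schur_product \<phi> T S"
    using T(1) by (auto simp: schur_multiplier_function_def)
  have le: "real n \<le> 8 * (norm S)\<^sup>2" for n
  proof -
    define X Y where "X = (\<Sum>j\<in>B n. x n j *\<^sub>R basis_vec j)" and "Y = (\<Sum>i\<in>A n. y n i *\<^sub>R basis_vec i)"
    have nX: "(norm X)\<^sup>2 = (\<Sum>j\<in>B n. (x n j)\<^sup>2)" and nY: "(norm Y)\<^sup>2 = (\<Sum>i\<in>A n. (y n i)\<^sup>2)"
      by (simp_all add: X_def Y_def norm_sum_basis_squared fin)
    have "Re (entry S (i, j)) = s n i j * b n i j" if "i \<in> A n" "j \<in> B n" for i j
      using S that T_entry[OF that] idx[OF that(1)] by (auto simp: is_schur_product_def \<phi>_def)
    then have "blinfun_apply S X \<bullet> Y = (\<Sum>i\<in>A n. \<Sum>j\<in>B n. s n i j * b n i j * x n j * y n i)"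
      unfolding X_def Y_def inner_apply_sum_basis by (intro sum.cong refl) simp
    moreover have "\<bar>blinfun_apply S X \<bullet> Y\<bar> \<le> norm S * norm X * norm Y"
      by (meson Cauchy_Schwarz_ineq2 mult_right_mono norm_blinfun norm_ge_zero order_trans)
    ultimately have "(\<Sum>i\<in>A n. \<Sum>j\<in>B n. s n i j * b n i j * x n j * y n i)\<^sup>2 \<le> (norm S * norm X * norm Y)\<^sup>2"
      by (simp only: abs_le_square_iff[symmetric])
    moreover have "0 < (norm X)\<^sup>2 * (norm Y)\<^sup>2"
      "n * ((norm X)\<^sup>2 * (norm Y)\<^sup>2) \<le> 8 * (\<Sum>i\<in>A n. \<Sum>j\<in>B n. s n i j * b n i j * x n j * y n i)\<^sup>2"
      using block[of n] unfolding sign_block_def nX nY by auto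
    ultimately have "n * ((norm X)\<^sup>2 * (norm Y)\<^sup>2) \<le> (8 * (norm S)\<^sup>2) * ((norm X)\<^sup>2 * (norm Y)\<^sup>2)"
      by (simp add: power_mult_distrib mult_ac)
    then show ?thesis using \<open>0 < (norm X)\<^sup>2 * (norm Y)\<^sup>2\<close> by (simp only: mult_le_cancel_right_pos)
  qed
  obtain n where "8 * (norm S)\<^sup>2 < real n" using reals_Archimedean2 by blast
  then show False using le[of n] by linarith
qed

section \<open>Splitting a Schur bounded pattern\<close>

text \<open>Peeling: a row or column with fewer than \<open>D\<close> points is deleted and its
  points are put into \<open>R\<close> or \<open>C\<close> respectively. A deleted row does not
  occur in the remaining rectangle, so its section of \<open>R\<close> consists of just these
  points; likewise for columns and \<open>C\<close>.\<close>

lemma finite_degenerate_split: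
  fixes \<kappa> :: "('a \<times> 'b) set"
  assumes degenerate: "\<And>A B. finite A \<Longrightarrow> finite B \<Longrightarrow> A \<noteq> {} \<Longrightarrow> B \<noteq> {} \<Longrightarrow>
      (\<exists>i\<in>A. card {j \<in> B. (i, j) \<in> \<kappa>} < D) \<or> (\<exists>j\<in>B. card {i \<in> A. (i, j) \<in> \<kappa>} < D)"
    and "finite A" "finite B"
  shows "\<exists>R C. \<kappa> \<inter> A \<times> B = R \<union> C \<and> (\<forall>i. card {j. (i, j) \<in> R} \<le> D) \<and> (\<forall>j. card {i. (i, j) \<in> C} \<le> D)"
  using assms(2,3)
proof (induction "card A + card B" arbitrary: A B rule: less_induct)
  case less
  show ?case
  proof (cases "A = {} \<or> B = {}")
    case True
    then show ?thesis by (intro exI[of _ "{}"]) auto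
  next
    case False
    then consider (row) i where "i \<in> A" "card {j \<in> B. (i, j) \<in> \<kappa>} < D"
      | (col) j where "j \<in> B" "card {i \<in> A. (i, j) \<in> \<kappa>} < D"
      using degenerate[of A B] less.prems by blast
    then show ?thesis
    proof cases
      case row
      have "card (A - {i}) + card B < card A + card B"
        using card_Diff1_less[OF less.prems(1) row(1)] by linarith
      from less.hyps[OF this] obtain R C where RC: "\<kappa> \<inter> (A - {i}) \<times> B = R \<union> C"
        "\<forall>i. card {j. (i, j) \<in> R} \<le> D" "\<forall>j. card {i. (i, j) \<in> C} \<le> D"
        using less.prems by auto
      let ?R = "R \<union> {i} \<times> {j \<in> B. (i, j) \<in> \<kappa>}"
      have iR: "(i, j) \<notin> R" for j using RC(1) by blast
      have "card {j. (k, j) \<in> ?R} \<le> D" for k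
        using RC(2) row(2) iR by (cases "k = i") auto
      moreover have "\<kappa> \<inter> A \<times> B = ?R \<union> C"
      proof (rule set_eqI)
        fix e :: "'a \<times> 'b"
        obtain a b where e: "e = (a, b)" by (cases e)
        have "e \<in> \<kappa> \<inter> (A - {i}) \<times> B \<longleftrightarrow> e \<in> R \<union> C" using RC(1) by simp
        then show "e \<in> \<kappa> \<inter> A \<times> B \<longleftrightarrow> e \<in> ?R \<union> C" using row(1) unfolding e by auto
      qed
      ultimately show ?thesis using RC(3) by blast
    next
      case col
      have "card A + card (B - {j}) < card A + card B"
        using card_Diff1_less[OF less.prems(2) col(1)] by linarith
      from less.hyps[OF this] obtain R C where RC: "\<kappa> \<inter> A \<times> (B - {j}) = R \<union> C"
        "\<forall>i. card {j. (i, j) \<in> R} \<le> D" "\<forall>j. card {i. (i, j) \<in> C} \<le> D"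
        using less.prems by auto
      let ?C = "C \<union> {i \<in> A. (i, j) \<in> \<kappa>} \<times> {j}"
      have jC: "(i, j) \<notin> C" for i using RC(1) by blast
      have "card {i. (i, k) \<in> ?C} \<le> D" for k
        using RC(3) col(2) jC by (cases "k = j") auto
      moreover have "\<kappa> \<inter> A \<times> B = R \<union> ?C"
      proof (rule set_eqI)
        fix e :: "'a \<times> 'b"
        obtain a b where e: "e = (a, b)" by (cases e)
        have "e \<in> \<kappa> \<inter> A \<times> (B - {j}) \<longleftrightarrow> e \<in> R \<union> C" using RC(1) by simp
        then show "e \<in> \<kappa> \<inter> A \<times> B \<longleftrightarrow> e \<in> R \<union> ?C" using col(1) unfolding e by auto
      qed
      ultimately show ?thesis using RC(2) by blast
    qed
  qed
qed

definition row_column_split :: "nat \<Rightarrow> (nat \<times> nat) set \<Rightarrow> (nat \<times> nat) set \<Rightarrow> bool" where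
  "row_column_split D R C \<longleftrightarrow> R \<inter> C = {} \<and>
    (\<forall>i. finite {j. (i, j) \<in> R} \<and> card {j. (i, j) \<in> R} \<le> D) \<and>
    (\<forall>j. finite {i. (i, j) \<in> C} \<and> card {i. (i, j) \<in> C} \<le> D)"

text \<open>Compactness of {0,1}^(N x N): along a subsequence the sets \<open>R n\<close> converge
  pointwise. The degree bounds concern finite subsets of a single row or column, so they pass to the
  limit.\<close>

lemma split_compactness:
  fixes \<kappa> :: "(nat \<times> nat) set"
  assumes "\<And>n. \<exists>R C. \<kappa> \<inter> {..<n} \<times> {..<n} = R \<union> C \<and>
      (\<forall>i. card {j. (i, j) \<in> R} \<le> D) \<and> (\<forall>j. card {i. (i, j) \<in> C} \<le> D)"
  shows "\<exists>R C. \<kappa> = R \<union> C \<and> row_column_split D R C"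
proof -
  obtain R C where RC: "\<And>n. \<kappa> \<inter> {..<n} \<times> {..<n} = R n \<union> C n"
    "\<And>n i. card {j. (i, j) \<in> R n} \<le> D" "\<And>n j. card {i. (i, j) \<in> C n} \<le> D"
    using assms by metis
  define f where "f n p = (if p \<in> R n then 1 else 0 :: real)" for n p
  obtain k where k: "strict_mono k" and lim: "\<And>p. \<exists>l. (\<lambda>n. f (k n) p) \<longlonglongrightarrow> l"
    by (rule function_convergent_subsequence[of UNIV f 1]) (simp, simp add: f_def, blast)
  \<comment> \<open>A convergent sequence of zeros and ones is eventually constant.\<close>
  have ev: "(\<forall>\<^sub>F n in sequentially. p \<in> R (k n)) \<or> (\<forall>\<^sub>F n in sequentially. p \<notin> R (k n))" for p
  proof -
    obtain l where l: "(\<lambda>n. f (k n) p) \<longlonglongrightarrow> l" using lim by blast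
    show ?thesis
    proof (cases "0 < l")
      case True
      then have "\<forall>\<^sub>F n in sequentially. 0 < f (k n) p" using order_tendstoD(1)[OF l] by blast
      then show ?thesis by (auto simp: f_def elim!: eventually_mono split: if_splits)
    next
      case False
      then have "\<forall>\<^sub>F n in sequentially. f (k n) p < 1" using order_tendstoD(2)[OF l, of 1] by auto
      then show ?thesis by (auto simp: f_def elim!: eventually_mono split: if_splits)
    qed
  qed
  \<comment> \<open>\<open>card\<close> is 0 on infinite sets, so the degree bounds carry
    information only because these truncations are finite.\<close>
  have finRC: "finite (R n)" "finite (C n)" for n
    using RC(1)[of n] by (metis finite_Int finite_Un finite_SigmaI finite_lessThan)+
  define R' where "R' = {p \<in> \<kappa>. \<forall>\<^sub>F n in sequentially. p \<in> R (k n)}"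
  have rows: "finite {j. (i, j) \<in> R'} \<and> card {j. (i, j) \<in> R'} \<le> D" for i
  proof (rule finite_if_finite_subsets_card_bdd)
    show "card F \<le> D" if F: "F \<subseteq> {j. (i, j) \<in> R'}" "finite F" for F
    proof -
      have "\<forall>\<^sub>F n in sequentially. \<forall>j\<in>F. (i, j) \<in> R (k n)"
        using F by (intro eventually_ball_finite) (auto simp: R'_def)
      then obtain n where n: "\<forall>j\<in>F. (i, j) \<in> R (k n)"
        using eventually_happens' sequentially_bot by blast
      have "finite {j. (i, j) \<in> R (k n)}"
        by (rule finite_subset[of _ "snd ` R (k n)"]) (force simp: finRC)+
      then have "card F \<le> card {j. (i, j) \<in> R (k n)}" using n by (intro card_mono) auto
      then show ?thesis using RC(2) le_trans by blast
    qed
  qed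
  have cols: "finite {i. (i, j) \<in> \<kappa> - R'} \<and> card {i. (i, j) \<in> \<kappa> - R'} \<le> D" for j
  proof (rule finite_if_finite_subsets_card_bdd)
    show "card F \<le> D" if F: "F \<subseteq> {i. (i, j) \<in> \<kappa> - R'}" "finite F" for F
    proof -
      have "\<forall>\<^sub>F n in sequentially. (i, j) \<in> C (k n)" if "i \<in> F" for i
      proof -
        \<comment> \<open>A point of \<kappa> left out of \<open>R'\<close> is eventually outside
          \<open>R (k n)\<close>. As \<open>n \<le> k n\<close>, it is eventually inside the
          truncating square too, hence in \<open>C (k n)\<close>.\<close>
        have ij: "(i, j) \<in> \<kappa>" "\<forall>\<^sub>F n in sequentially. (i, j) \<notin> R (k n)"
          using that F(1) ev[of "(i, j)"] by (auto simp: R'_def)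
        have "\<forall>\<^sub>F n in sequentially. max i j < n" by (rule eventually_gt_at_top)
        with ij(2) show ?thesis
        proof eventually_elim
          case (elim n)
          then have "max i j < k n" using strict_mono_imp_increasing[OF k, of n] by linarith
          then have "(i, j) \<in> \<kappa> \<inter> {..<k n} \<times> {..<k n}" using ij(1) by simp
          then show ?case using elim(1) RC(1)[of "k n"] by blast
        qed
      qed
      then have "\<forall>\<^sub>F n in sequentially. \<forall>i\<in>F. (i, j) \<in> C (k n)"
        using F(2) by (intro eventually_ball_finite) auto
      then obtain n where n: "\<forall>i\<in>F. (i, j) \<in> C (k n)"
        using eventually_happens' sequentially_bot by blast
      have "finite {i. (i, j) \<in> C (k n)}"
        by (rule finite_subset[of _ "fst ` C (k n)"]) (force simp: finRC)+
      then have "card F \<le> card {i. (i, j) \<in> C (k n)}" using n by (intro card_mono) auto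
      then show ?thesis using RC(3) le_trans by blast
    qed
  qed
  have "\<kappa> = R' \<union> (\<kappa> - R')" "R' \<inter> (\<kappa> - R') = {}" by (auto simp: R'_def)
  with rows cols show ?thesis unfolding row_column_split_def by blast
qed

lemma card_subset_Un_lessThan:
  assumes "finite S \<and> card S \<le> D" "T \<subseteq> S \<union> {..<p}"
  shows "finite T \<and> card T \<le> D + p"
proof -
  have "finite (S \<union> {..<p})" using assms by simp
  then have "finite T" "card T \<le> card (S \<union> {..<p})"
    using assms by (auto intro: finite_subset card_mono)
  then show ?thesis using card_Un_le[of S "{..<p}"] assms(1) by simp
qed

text \<open>For some \<open>p\<close> and \<open>D\<close> no block lives beyond \<open>p\<close>,
  so every finite rectangle there has a sparse row or column and can be peeled. The finitely many
  rows and columns below \<open>p\<close> are put back at a cost of \<open>p\<close> in each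
  degree.\<close>

lemma schur_bounded_pattern_split:
  assumes "schur_bounded_pattern \<kappa>"
  shows "\<exists>N R C. \<kappa> = R \<union> C \<and> row_column_split N R C"
proof -
  have "\<exists>p D. \<forall>q A B s b x y. A \<subseteq> {p..<q} \<longrightarrow> B \<subseteq> {p..<q} \<longrightarrow> \<not> sign_block \<kappa> D A B s b x y"
  proof (rule ccontr)
    assume "\<not> ?thesis"
    then have "\<exists>q A B s b x y. A \<subseteq> {p..<q} \<and> B \<subseteq> {p..<q} \<and> sign_block \<kappa> D A B s b x y" for p D
      by meson
    then show False by (rule no_escaping_sign_blocks[OF assms])
  qed
  then obtain p D where no_block:
    "\<And>q A B s b x y. A \<subseteq> {p..<q} \<Longrightarrow> B \<subseteq> {p..<q} \<Longrightarrow> \<not> sign_block \<kappa> D A B s b x y"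
    by meson
  define \<kappa>' where "\<kappa>' = \<kappa> \<inter> {p..} \<times> {p..}"
  \<comment> \<open>\<open>Suc D\<close> is positive, as the block construction requires. It also
    forces every row and column of a dense rectangle to meet \<kappa>', hence to lie beyond
    \<open>p\<close>.\<close>
  have "(\<exists>i\<in>A. card {j \<in> B. (i, j) \<in> \<kappa>'} < Suc D) \<or> (\<exists>j\<in>B. card {i \<in> A. (i, j) \<in> \<kappa>'} < Suc D)"
    if fin: "finite A" "finite B" and ne: "A \<noteq> {}" "B \<noteq> {}" for A B
  proof (rule ccontr)
    assume "\<not> ?thesis"
    then have deg: "\<And>i. i \<in> A \<Longrightarrow> Suc D \<le> card {j \<in> B. (i, j) \<in> \<kappa>'}"
      "\<And>j. j \<in> B \<Longrightarrow> Suc D \<le> card {i \<in> A. (i, j) \<in> \<kappa>'}" by (auto simp: not_less)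
    have "{j \<in> B. (i, j) \<in> \<kappa>'} \<noteq> {}" if "i \<in> A" for i using deg(1)[OF that] by (metis card.empty not_less_eq_eq le0)
    then have "A \<subseteq> {p..}" by (auto simp: \<kappa>'_def)
    have "{i \<in> A. (i, j) \<in> \<kappa>'} \<noteq> {}" if "j \<in> B" for j using deg(2)[OF that] by (metis card.empty not_less_eq_eq le0)
    then have "B \<subseteq> {p..}" by (auto simp: \<kappa>'_def)
    obtain q where "A \<union> B \<subseteq> {..<q}"
      using fin finite_nat_iff_bounded[of "A \<union> B"] by auto
    with \<open>A \<subseteq> {p..}\<close> \<open>B \<subseteq> {p..}\<close> have "A \<subseteq> {p..<q}" "B \<subseteq> {p..<q}" by fastforce+
    moreover obtain s b x y where "sign_block \<kappa>' (Suc D) A B s b x y"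
      using sign_block_exists[OF fin ne _ deg] by blast
    then have "sign_block \<kappa> D A B s b x y"
    proof -
      assume *: "sign_block \<kappa>' (Suc D) A B s b x y"
      have "0 < (\<Sum>j\<in>B. (x j)\<^sup>2) * (\<Sum>i\<in>A. (y i)\<^sup>2)" using * by (simp add: sign_block_def)
      then have "D * ((\<Sum>j\<in>B. (x j)\<^sup>2) * (\<Sum>i\<in>A. (y i)\<^sup>2))
          \<le> real (Suc D) * ((\<Sum>j\<in>B. (x j)\<^sup>2) * (\<Sum>i\<in>A. (y i)\<^sup>2))"
        by (intro mult_right_mono) auto
      also have "\<dots> \<le> 8 * (\<Sum>i\<in>A. \<Sum>j\<in>B. s i j * b i j * x j * y i)\<^sup>2"
        using * by (simp only: sign_block_def)
      finally show ?thesis using * unfolding sign_block_def \<kappa>'_def by blast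
    qed
    ultimately show False using no_block by blast
  qed
  then have "\<exists>R C. \<kappa>' = R \<union> C \<and> row_column_split (Suc D) R C"
    by (intro split_compactness finite_degenerate_split) auto
  then obtain R C where RC: "\<kappa>' = R \<union> C" "row_column_split (Suc D) R C" by blast
  \<comment> \<open>The columns below \<open>p\<close> add at most \<open>p\<close> points to each
    row of \<open>R\<close>, the rows below \<open>p\<close> at most \<open>p\<close> points to each
    column of \<open>C\<close>; subtracting \<open>R'\<close> keeps the two parts disjoint.\<close>
  define R' where "R' = R \<union> (\<kappa> \<inter> UNIV \<times> {..<p})"
  define C' where "C' = C \<union> (\<kappa> \<inter> {..<p} \<times> UNIV) - R'"
  have "finite {j. (i, j) \<in> R'} \<and> card {j. (i, j) \<in> R'} \<le> Suc D + p" for i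
    by (rule card_subset_Un_lessThan[where S = "{j. (i, j) \<in> R}"])
      (use RC(2) in \<open>auto simp: R'_def row_column_split_def\<close>)
  moreover have "finite {i. (i, j) \<in> C'} \<and> card {i. (i, j) \<in> C'} \<le> Suc D + p" for j
    by (rule card_subset_Un_lessThan[where S = "{i. (i, j) \<in> C}"])
      (use RC(2) in \<open>auto simp: C'_def row_column_split_def\<close>)
  moreover have "R' \<inter> C' = {}" by (auto simp: C'_def)
  moreover have "\<kappa> = R' \<union> C'"
  proof (rule set_eqI)
    fix e :: "nat \<times> nat"
    obtain i j where e: "e = (i, j)" by (cases e)
    have "e \<in> \<kappa>' \<longleftrightarrow> e \<in> R \<union> C" using RC(1) by simp
    then show "e \<in> \<kappa> \<longleftrightarrow> e \<in> R' \<union> C'"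
      unfolding R'_def C'_def \<kappa>'_def e by auto
  qed
  ultimately show ?thesis unfolding row_column_split_def by blast
qed

section \<open>The distance estimate\<close>

lemma inner_proj_finite:
  assumes "finite A"
  shows "z \<bullet> proj A y = (\<Sum>i\<in>A. coord z i \<bullet> coord y i)"
proof -
  have "(\<Sum>i. coord z i \<bullet> coord (proj A y) i) = (\<Sum>i\<in>A. coord z i \<bullet> coord (proj A y) i)"
    by (rule suminf_finite) (use assms in auto)
  then show ?thesis by (simp add: inner_ell2.rep_eq)
qed

lemma inner_apply_proj:
  assumes "T \<in> BH" "finite A" "finite B"
  shows "blinfun_apply T (proj B x) \<bullet> proj A y
    = (\<Sum>i\<in>A. \<Sum>j\<in>B. (entry T (i, j) * coord x j) \<bullet> coord y i)"
  unfolding inner_proj_finite[OF assms(2)] apply_proj_finite[OF assms(1,3)]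
  by (simp add: inner_sum_left entry_eq_coord mult.commute)

text \<open>Elements of the subspace vanish on the rectangle, so any of them may be subtracted from
  \<open>T\<close> without changing the pairing. For a fixed unit vector this bounds the pairing by
  the infimum; only afterwards is the supremum taken.\<close>

lemma alpha_rectangle_bound:
  assumes T: "T \<in> BH" and AB: "A \<times> B \<inter> \<kappa> = {}"
    and \<X>: "0 \<in> \<X>" "\<And>X p. X \<in> \<X> \<Longrightarrow> X \<in> BH" "\<And>X p. X \<in> \<X> \<Longrightarrow> p \<notin> \<kappa> \<Longrightarrow> entry X p = 0"
  shows "\<bar>blinfun_apply T (proj B x) \<bullet> proj A y\<bar> \<le> alpha T \<X> * (norm x * norm y)"
    and "0 \<le> alpha T \<X>"
proof -
  define g where "g \<xi> = (INF X\<in>\<X>. norm (blinfun_apply T \<xi> - blinfun_apply X \<xi>))" for \<xi>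
  have bdd: "bdd_below ((\<lambda>X. norm (blinfun_apply T \<xi> - blinfun_apply X \<xi>)) ` \<X>)" for \<xi>
    by (rule bdd_belowI[of _ 0]) auto
  have g_le: "g \<xi> \<le> alpha T \<X>" if "norm \<xi> = 1" for \<xi>
    unfolding alpha_def g_def[symmetric]
  proof (rule cSUP_upper)
    \<comment> \<open>The real supremum is meaningful only over a bounded set; the element 0 of the
      subspace provides the bound \<open>norm T\<close>.\<close>
    show "bdd_above (g ` {\<xi>. norm \<xi> = 1})"
    proof (rule bdd_aboveI2)
      fix \<xi> :: ell2 assume "\<xi> \<in> {\<xi>. norm \<xi> = 1}"
      then have "norm (blinfun_apply T \<xi> - blinfun_apply 0 \<xi>) \<le> norm T"
        using norm_blinfun[of T \<xi>] by simp
      then show "g \<xi> \<le> norm T"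
        unfolding g_def by (rule cINF_lower2[OF bdd \<X>(1)])
    qed
  qed (use that in simp)
  have "0 \<le> g (basis_vec 0)" unfolding g_def by (rule cINF_greatest) (use \<X>(1) in auto)
  then show alpha_nonneg: "0 \<le> alpha T \<X>" using g_le[of "basis_vec 0"] by simp
  define \<xi> where "\<xi> = proj B x"
  have zero: "blinfun_apply X \<xi> \<bullet> proj A y = 0" if "X \<in> \<X>" for X
  proof -
    have "coord (blinfun_apply X \<xi>) i = 0" if "i \<in> A" for i
    proof -
      have "(\<lambda>j. entry X (i, j) * coord \<xi> j) = (\<lambda>j. 0)"
        using AB \<X>(3)[OF \<open>X \<in> \<X>\<close>] that by (auto simp: \<xi>_def fun_eq_iff)
      then show ?thesis
        using coord_apply_sums[OF \<X>(2)[OF \<open>X \<in> \<X>\<close>], of i \<xi>] sums_unique2[OF sums_zero] by simp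
    qed
    then have "proj A (blinfun_apply X \<xi>) = 0" by (intro ell2_eqI) simp
    then show ?thesis by (metis inner_proj inner_zero_left)
  qed
  have unit: "\<bar>blinfun_apply T u \<bullet> proj A y\<bar> \<le> alpha T \<X> * norm y" if u: "u = c *\<^sub>R \<xi>" "norm u = 1" for u c
  proof (cases "norm y = 0")
    case True
    then have "proj A y = 0" by (metis norm_proj_le norm_le_zero_iff)
    then show ?thesis using True by simp
  next
    case False
    then have ypos: "0 < norm y" by simp
    have "\<bar>blinfun_apply T u \<bullet> proj A y\<bar> / norm y \<le> g u"
      unfolding g_def
    proof (rule cINF_greatest)
      fix X assume "X \<in> \<X>"
      then have "blinfun_apply T u \<bullet> proj A y = (blinfun_apply T u - blinfun_apply X u) \<bullet> proj A y"
        using zero by (simp add: inner_diff_left u(1) blinfun.scaleR_right)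
      also have "\<bar>\<dots>\<bar> \<le> norm (blinfun_apply T u - blinfun_apply X u) * norm (proj A y)"
        by (rule Cauchy_Schwarz_ineq2)
      also have "\<dots> \<le> norm (blinfun_apply T u - blinfun_apply X u) * norm y"
        by (intro mult_left_mono norm_proj_le) simp
      finally show "\<bar>blinfun_apply T u \<bullet> proj A y\<bar> / norm y \<le> norm (blinfun_apply T u - blinfun_apply X u)"
        using ypos by (simp only: pos_divide_le_eq)
    qed (use \<X>(1) in auto)
    also have "\<dots> \<le> alpha T \<X>" by (rule g_le[OF u(2)])
    finally show ?thesis using ypos by (simp only: pos_divide_le_eq)
  qed
  show "\<bar>blinfun_apply T (proj B x) \<bullet> proj A y\<bar> \<le> alpha T \<X> * (norm x * norm y)"
  proof (cases "\<xi> = 0")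
    case True
    then show ?thesis using alpha_nonneg by (simp add: \<xi>_def[symmetric])
  next
    case False
    \<comment> \<open>\<alpha> tests unit vectors only, so \<open>proj B x\<close> is normalized;
      undoing this costs its norm, at most \<open>norm x\<close>.\<close>
    define u where "u = (1 / norm \<xi>) *\<^sub>R \<xi>"
    have "\<bar>blinfun_apply T u \<bullet> proj A y\<bar> \<le> alpha T \<X> * norm y"
      by (rule unit[OF u_def]) (use False in \<open>simp add: u_def\<close>)
    then have "norm \<xi> * \<bar>blinfun_apply T u \<bullet> proj A y\<bar> \<le> norm \<xi> * (alpha T \<X> * norm y)"
      by (rule mult_left_mono) simp
    also have "\<dots> \<le> norm x * (alpha T \<X> * norm y)"
      using alpha_nonneg by (intro mult_right_mono) (auto simp: \<xi>_def norm_proj_le)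
    also have "norm \<xi> * \<bar>blinfun_apply T u \<bullet> proj A y\<bar> = \<bar>blinfun_apply T \<xi> \<bullet> proj A y\<bar>"
      using False by (simp add: u_def blinfun.scaleR_right abs_mult)
    finally show ?thesis by (simp add: \<xi>_def mult_ac)
  qed
qed

section \<open>Averaging over random rectangles\<close>

text \<open>The two conditions prescribe membership of \<open>i\<close> and of the points of
  \<open>F\<close> in \<open>U\<close>, leaving the rest free. So the probability is 2 to the power
  -(1 + |F \<inter> U|), or 0 if \<open>i\<close> itself is forbidden; it is stated in
  integers.\<close>

lemma card_subsets_containing_avoiding:
  assumes "finite U" "i \<in> U"
  shows "card {A \<in> Pow U. i \<in> A \<and> A \<inter> F = {}} * 2 ^ Suc (card (F \<inter> U)) = (if i \<in> F then 0 else 2 ^ card U)"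
proof (cases "i \<in> F")
  case True
  then have "{A \<in> Pow U. i \<in> A \<and> A \<inter> F = {}} = {}" by blast
  then show ?thesis using True by (simp only: card.empty) simp
next
  case False
  let ?W = "U - F - {i}"
  have "{A \<in> Pow U. i \<in> A \<and> A \<inter> F = {}} = insert i ` Pow ?W"
  proof (intro equalityI subsetI)
    fix A assume "A \<in> {A \<in> Pow U. i \<in> A \<and> A \<inter> F = {}}"
    then have "A = insert i (A - {i})" "A - {i} \<in> Pow ?W" by auto
    then show "A \<in> insert i ` Pow ?W" by blast
  qed (use assms False in auto)
  moreover have "inj_on (insert i) (Pow ?W)" by (auto simp: inj_on_def)
  ultimately have c: "card {A \<in> Pow U. i \<in> A \<and> A \<inter> F = {}} = 2 ^ card ?W"
    using assms by (simp add: card_image card_Pow)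
  have "card U = card (U \<inter> F) + card (U - F)" by (rule card_Int_Diff[OF assms(1)])
  also have "card (U - F) = Suc (card ?W)"
    using assms False by (intro card_Suc_Diff1[symmetric]) auto
  finally have "card U = card ?W + Suc (card (F \<inter> U))" by (simp add: Int_commute)
  then show ?thesis using False c by (simp add: power_add)
qed

text \<open>The diagonal operator with entries \<open>w\<close>, cut off at \<open>n\<close> so that
  it is defined for every \<open>w\<close>.\<close>

definition weight :: "nat \<Rightarrow> (nat \<Rightarrow> real) \<Rightarrow> ell2 \<Rightarrow> ell2" where
  "weight n w x = (\<Sum>j<n. (w j * coord x j) *\<^sub>C basis_vec j)"

lemma coord_weight: "coord (weight n w x) i = (if i < n then w i * coord x i else 0)"
  by (simp add: weight_def coord_basis_vec if_distrib cong: if_cong)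

lemma norm_weight_le:
  assumes "\<And>i. \<bar>w i\<bar> \<le> K" "0 \<le> K"
  shows "norm (weight n w x) \<le> K * norm x"
proof -
  have "(norm (weight n w x))\<^sup>2 \<le> (\<Sum>i. K\<^sup>2 * (cmod (coord x i))\<^sup>2)"
    unfolding norm_ell2_squared
  proof (intro suminf_le summable_coord summable_mult)
    show "(cmod (coord (weight n w x) i))\<^sup>2 \<le> K\<^sup>2 * (cmod (coord x i))\<^sup>2" for i
      using power_mono[OF assms(1)[of i], of 2]
      by (auto simp: coord_weight norm_mult power_mult_distrib intro: mult_right_mono)
  qed
  also have "\<dots> = (K * norm x)\<^sup>2"
    by (simp add: suminf_mult summable_coord norm_ell2_squared power_mult_distrib)
  finally show ?thesis using assms(2) by (simp add: abs_le_square_iff[symmetric])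
qed

text \<open>For random \<open>A\<close> and \<open>B\<close>, entry \<open>(i, j)\<close> is
  retained when an event about \<open>A\<close> and an independent event about \<open>B\<close> both
  occur. Their probabilities are 1 / \<open>2 ^ Suc (c j)\<close> and 1 /
  \<open>2 ^ Suc (r i)\<close>, except that one of them is impossible when \<open>(i, j)\<close>
  lies in \<open>C\<close> or in \<open>R\<close>. The weights cancel these probabilities, and
  \<open>4 ^ n\<close> counts the pairs \<open>(A, B)\<close>.\<close>

lemma averaged_rectangles:
  fixes n :: nat and R C :: "(nat \<times> nat) set"
  assumes T: "T \<in> BH" and S: "is_schur_product (indicator (R \<union> C)) T S"
  defines "r i \<equiv> card ({j. (i, j) \<in> R} \<inter> {..<n})" and "c j \<equiv> card ({i. (i, j) \<in> C} \<inter> {..<n})"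
  shows "(\<Sum>A\<in>Pow {..<n}. \<Sum>B\<in>Pow {..<n}.
      blinfun_apply T (proj {j\<in>B. A \<inter> {i. (i, j) \<in> C} = {}} (weight n (\<lambda>j. 2 ^ Suc (c j)) x))
        \<bullet> proj {i\<in>A. B \<inter> {j. (i, j) \<in> R} = {}} (weight n (\<lambda>i. 2 ^ Suc (r i)) y))
    = 4 ^ n * (blinfun_apply (T - S) (proj {..<n} x) \<bullet> proj {..<n} y)"
proof -
  let ?U = "{..<n}"
  define m where "m i j = (entry T (i, j) * coord x j) \<bullet> coord y i" for i j
  \<comment> \<open>The conditions are regrouped by random set instead of by side of the rectangle:
    \<open>a\<close> involves only \<open>A\<close>, and \<open>b\<close> only \<open>B\<close>, so
    that the double average factors for each entry.\<close>
  define a where "a A i j = (if i \<in> A \<and> A \<inter> {i. (i, j) \<in> C} = {} then 1 else 0 :: real)" for A i j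
  define b where "b B i j = (if j \<in> B \<and> B \<inter> {j. (i, j) \<in> R} = {} then 1 else 0 :: real)" for B i j
  have a_sum: "(\<Sum>A\<in>Pow ?U. a A i j) * 2 ^ Suc (c j) = (if (i, j) \<in> C then 0 else 2 ^ n)" if "i < n" for i j
  proof -
    have "(\<Sum>A\<in>Pow ?U. a A i j) = card {A \<in> Pow ?U. i \<in> A \<and> A \<inter> {i. (i, j) \<in> C} = {}}"
      unfolding a_def by (subst sum.inter_filter[symmetric]) auto
    then have "(\<Sum>A\<in>Pow ?U. a A i j) * 2 ^ Suc (c j)
        = real (card {A \<in> Pow ?U. i \<in> A \<and> A \<inter> {i. (i, j) \<in> C} = {}} * 2 ^ Suc (c j))"
      by simp
    also have "\<dots> = (if (i, j) \<in> C then 0 else 2 ^ n)"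
      unfolding c_def by (subst card_subsets_containing_avoiding) (use that in auto)
    finally show ?thesis .
  qed
  have b_sum: "(\<Sum>B\<in>Pow ?U. b B i j) * 2 ^ Suc (r i) = (if (i, j) \<in> R then 0 else 2 ^ n)" if "j < n" for i j
  proof -
    have "(\<Sum>B\<in>Pow ?U. b B i j) = card {B \<in> Pow ?U. j \<in> B \<and> B \<inter> {j. (i, j) \<in> R} = {}}"
      unfolding b_def by (subst sum.inter_filter[symmetric]) auto
    then have "(\<Sum>B\<in>Pow ?U. b B i j) * 2 ^ Suc (r i)
        = real (card {B \<in> Pow ?U. j \<in> B \<and> B \<inter> {j. (i, j) \<in> R} = {}} * 2 ^ Suc (r i))"
      by simp
    also have "\<dots> = (if (i, j) \<in> R then 0 else 2 ^ n)"
      unfolding r_def by (subst card_subsets_containing_avoiding) (use that in auto)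
    finally show ?thesis .
  qed
  have summand: "blinfun_apply T (proj {j\<in>B. A \<inter> {i. (i, j) \<in> C} = {}} (weight n (\<lambda>j. 2 ^ Suc (c j)) x))
        \<bullet> proj {i\<in>A. B \<inter> {j. (i, j) \<in> R} = {}} (weight n (\<lambda>i. 2 ^ Suc (r i)) y)
      = (\<Sum>i<n. \<Sum>j<n. a A i j * 2 ^ Suc (c j) * (b B i j * 2 ^ Suc (r i)) * m i j)"
    if AB: "A \<in> Pow ?U" "B \<in> Pow ?U" for A B
  proof -
    let ?B = "{j\<in>B. A \<inter> {i. (i, j) \<in> C} = {}}" and ?A = "{i\<in>A. B \<inter> {j. (i, j) \<in> R} = {}}"
    have sub: "?A \<subseteq> ?U" "?B \<subseteq> ?U" using AB by auto
    then have fin: "finite ?A" "finite ?B" using finite_subset[OF _ finite_lessThan] by blast+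
    have mem: "a A i j * 2 ^ Suc (c j) * (b B i j * 2 ^ Suc (r i)) * m i j
      = (if i \<in> ?A then if j \<in> ?B then 2 ^ Suc (c j) * 2 ^ Suc (r i) * m i j else 0 else 0)" for i j
      by (auto simp: a_def b_def)
    have "(\<Sum>i\<in>?A. \<Sum>j\<in>?B. (entry T (i, j) * coord (weight n (\<lambda>j. 2 ^ Suc (c j)) x) j)
          \<bullet> coord (weight n (\<lambda>i. 2 ^ Suc (r i)) y) i)
        = (\<Sum>i\<in>?A. \<Sum>j\<in>?B. 2 ^ Suc (c j) * 2 ^ Suc (r i) * m i j)"
    proof (intro sum.cong refl)
      fix i j assume "i \<in> ?A" "j \<in> ?B"
      then have "i < n" "j < n" using AB by auto
      have "coord (weight n (\<lambda>j. 2 ^ Suc (c j)) x) j = (2 ^ Suc (c j)) *\<^sub>R coord x j"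
        "coord (weight n (\<lambda>i. 2 ^ Suc (r i)) y) i = (2 ^ Suc (r i)) *\<^sub>R coord y i"
        using \<open>i < n\<close> \<open>j < n\<close> by (simp_all add: coord_weight scaleR_conv_of_real)
      then show "(entry T (i, j) * coord (weight n (\<lambda>j. 2 ^ Suc (c j)) x) j)
          \<bullet> coord (weight n (\<lambda>i. 2 ^ Suc (r i)) y) i = 2 ^ Suc (c j) * 2 ^ Suc (r i) * m i j"
        by (simp only: m_def mult_scaleR_right inner_scaleR_left inner_scaleR_right mult.assoc)
           (simp only: mult.left_commute)
    qed
    also have "\<dots> = (\<Sum>i\<in>?A. \<Sum>j<n. if j \<in> ?B then 2 ^ Suc (c j) * 2 ^ Suc (r i) * m i j else 0)"
      by (intro sum.cong refl sum.mono_neutral_cong_left) (use sub in auto)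
    also have "\<dots> = (\<Sum>i<n. if i \<in> ?A then \<Sum>j<n. if j \<in> ?B then 2 ^ Suc (c j) * 2 ^ Suc (r i) * m i j else 0 else 0)"
      by (intro sum.mono_neutral_cong_left) (use sub in auto)
    also have "\<dots> = (\<Sum>i<n. \<Sum>j<n. a A i j * 2 ^ Suc (c j) * (b B i j * 2 ^ Suc (r i)) * m i j)"
    proof (rule sum.cong[OF refl])
      fix i
      show "(if i \<in> ?A then \<Sum>j<n. if j \<in> ?B then 2 ^ Suc (c j) * 2 ^ Suc (r i) * m i j else 0 else 0)
        = (\<Sum>j<n. a A i j * 2 ^ Suc (c j) * (b B i j * 2 ^ Suc (r i)) * m i j)"
        unfolding mem by (cases "i \<in> ?A") (simp_all only: if_True if_False sum.neutral_const)
    qed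
    finally show ?thesis unfolding inner_apply_proj[OF T fin] .
  qed
  have S': "S \<in> BH" "entry S p = indicator (R \<union> C) p * entry T p" for p
    using S unfolding is_schur_product_def by blast+
  have "(\<Sum>A\<in>Pow ?U. \<Sum>B\<in>Pow ?U. \<Sum>i<n. \<Sum>j<n. a A i j * 2 ^ Suc (c j) * (b B i j * 2 ^ Suc (r i)) * m i j)
      = (\<Sum>i<n. \<Sum>j<n. \<Sum>A\<in>Pow ?U. \<Sum>B\<in>Pow ?U. a A i j * 2 ^ Suc (c j) * (b B i j * 2 ^ Suc (r i)) * m i j)"
    by (simp only: sum.swap[where A = "Pow ?U" and B = ?U])
  also have "\<dots> = (\<Sum>i<n. \<Sum>j<n. ((\<Sum>A\<in>Pow ?U. a A i j) * 2 ^ Suc (c j))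
      * ((\<Sum>B\<in>Pow ?U. b B i j) * 2 ^ Suc (r i)) * m i j)"
  proof (intro sum.cong refl)
    fix i j
    have "((\<Sum>A\<in>Pow ?U. a A i j) * 2 ^ Suc (c j)) * ((\<Sum>B\<in>Pow ?U. b B i j) * 2 ^ Suc (r i)) * m i j
        = (\<Sum>A\<in>Pow ?U. a A i j * 2 ^ Suc (c j)) * (\<Sum>B\<in>Pow ?U. b B i j * 2 ^ Suc (r i)) * m i j"
      by (simp only: sum_distrib_right)
    also have "\<dots> = (\<Sum>A\<in>Pow ?U. \<Sum>B\<in>Pow ?U. a A i j * 2 ^ Suc (c j) * (b B i j * 2 ^ Suc (r i))) * m i j"
      by (simp only: sum_product)
    finally show "(\<Sum>A\<in>Pow ?U. \<Sum>B\<in>Pow ?U. a A i j * 2 ^ Suc (c j) * (b B i j * 2 ^ Suc (r i)) * m i j)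
        = ((\<Sum>A\<in>Pow ?U. a A i j) * 2 ^ Suc (c j)) * ((\<Sum>B\<in>Pow ?U. b B i j) * 2 ^ Suc (r i)) * m i j"
      by (simp only: sum_distrib_right)
  qed
  also have "\<dots> = (\<Sum>i<n. \<Sum>j<n. 4 ^ n * ((entry (T - S) (i, j) * coord x j) \<bullet> coord y i))"
  proof (intro sum.cong refl)
    fix i j assume "i \<in> ?U" "j \<in> ?U"
    then have ab: "(\<Sum>A\<in>Pow ?U. a A i j) * 2 ^ Suc (c j) = (if (i, j) \<in> C then 0 else 2 ^ n)"
      "(\<Sum>B\<in>Pow ?U. b B i j) * 2 ^ Suc (r i) = (if (i, j) \<in> R then 0 else 2 ^ n)"
      using a_sum b_sum by auto
    have "(2::real) ^ n * 2 ^ n = 4 ^ n" by (simp add: power_mult_distrib[symmetric])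
    then show "((\<Sum>A\<in>Pow ?U. a A i j) * 2 ^ Suc (c j)) * ((\<Sum>B\<in>Pow ?U. b B i j) * 2 ^ Suc (r i)) * m i j
        = 4 ^ n * ((entry (T - S) (i, j) * coord x j) \<bullet> coord y i)"
      unfolding ab by (simp add: entry_diff S' m_def indicator_def)
  qed
  also have "\<dots> = 4 ^ n * (blinfun_apply (T - S) (proj ?U x) \<bullet> proj ?U y)"
    using inner_apply_proj[OF BH_diff[OF T S'(1)], of ?U ?U x y] by (simp add: sum_distrib_left)
  finally show ?thesis using summand by simp
qed

text \<open>The weights are at most \<open>2 ^ Suc N\<close> on each side, whence the constant
  \<open>4 ^ Suc N\<close>. The averaged identity bounds all truncations of \<open>T - S\<close>
  uniformly in \<open>n\<close>, and the bound survives the limit.\<close>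

lemma norm_perp_le_alpha:
  assumes T: "T \<in> BH" and S: "is_schur_product (indicator (R \<union> C)) T S" and split: "row_column_split N R C"
    and \<X>: "0 \<in> \<X>" "\<And>X. X \<in> \<X> \<Longrightarrow> X \<in> BH" "\<And>X p. X \<in> \<X> \<Longrightarrow> p \<notin> R \<union> C \<Longrightarrow> entry X p = 0"
  shows "norm (T - S) \<le> 4 ^ Suc N * alpha T \<X>"
proof -
  let ?K = "2 ^ Suc N :: real"
  have alpha_nonneg: "0 \<le> alpha T \<X>"
    by (rule alpha_rectangle_bound(2)[OF T, of "{}" "{}" "R \<union> C"]) (use \<X> in auto)
  have trunc: "\<bar>blinfun_apply (T - S) (proj {..<n} x) \<bullet> proj {..<n} y\<bar> \<le> 4 ^ Suc N * alpha T \<X> * norm x * norm y"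
    for n x y
  proof -
    define r where "r i = card ({j. (i, j) \<in> R} \<inter> {..<n})" for i
    define c where "c j = card ({i. (i, j) \<in> C} \<inter> {..<n})" for j
    define x' where "x' = weight n (\<lambda>j. 2 ^ Suc (c j)) x"
    define y' where "y' = weight n (\<lambda>i. 2 ^ Suc (r i)) y"
    have "r i \<le> N" "c i \<le> N" for i
      using split unfolding row_column_split_def r_def c_def by (meson card_mono inf_le1 le_trans)+
    then have "norm x' \<le> ?K * norm x" "norm y' \<le> ?K * norm y"
      unfolding x'_def y'_def by (auto intro!: norm_weight_le power_increasing simp del: power_Suc)
    then have xy: "norm x' * norm y' \<le> (?K * norm x) * (?K * norm y)"
      by (intro mult_mono) auto
    have "4 ^ n * \<bar>blinfun_apply (T - S) (proj {..<n} x) \<bullet> proj {..<n} y\<bar>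
        = \<bar>\<Sum>A\<in>Pow {..<n}. \<Sum>B\<in>Pow {..<n}.
            blinfun_apply T (proj {j\<in>B. A \<inter> {i. (i, j) \<in> C} = {}} x')
              \<bullet> proj {i\<in>A. B \<inter> {j. (i, j) \<in> R} = {}} y'\<bar>"
      unfolding x'_def y'_def r_def c_def averaged_rectangles[OF T S] by (simp add: abs_mult)
    also have "\<dots> \<le> (\<Sum>A\<in>Pow {..<n}. \<Sum>B\<in>Pow {..<n}. alpha T \<X> * (norm x' * norm y'))"
    proof (intro order_trans[OF sum_abs] sum_mono)
      fix A B
      \<comment> \<open>The rectangle avoids \<open>R \<union> C\<close>: a point of
        \<open>C\<close> in it would have its row index both in \<open>A\<close> and in a section
        that \<open>A\<close> misses; a point of \<open>R\<close> is excluded in the same way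
        through \<open>B\<close>.\<close>
      show "\<bar>blinfun_apply T (proj {j\<in>B. A \<inter> {i. (i, j) \<in> C} = {}} x')
          \<bullet> proj {i\<in>A. B \<inter> {j. (i, j) \<in> R} = {}} y'\<bar> \<le> alpha T \<X> * (norm x' * norm y')"
        by (rule alpha_rectangle_bound(1)[OF T _ \<X>, where \<kappa> = "R \<union> C"]) blast+
    qed
    also have "\<dots> = 4 ^ n * (alpha T \<X> * (norm x' * norm y'))"
      by (simp add: card_Pow power_mult_distrib[symmetric] mult.assoc[symmetric])
    also have "\<dots> \<le> 4 ^ n * (alpha T \<X> * ((?K * norm x) * (?K * norm y)))"
      using alpha_nonneg xy by (intro mult_left_mono) auto
    finally have "\<bar>blinfun_apply (T - S) (proj {..<n} x) \<bullet> proj {..<n} y\<bar>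
        \<le> alpha T \<X> * ((?K * norm x) * (?K * norm y))" by simp
    also have "\<dots> = (?K * ?K) * alpha T \<X> * norm x * norm y" by (simp only: mult_ac)
    also have "?K * ?K = 4 ^ Suc N" by (simp only: power_mult_distrib[symmetric]) simp
    finally show ?thesis .
  qed
  have bound: "\<bar>blinfun_apply (T - S) x \<bullet> y\<bar> \<le> 4 ^ Suc N * alpha T \<X> * norm x * norm y" for x y
  proof (rule tendsto_upperbound)
    show "(\<lambda>n. \<bar>blinfun_apply (T - S) (proj {..<n} x) \<bullet> proj {..<n} y\<bar>)
        \<longlonglongrightarrow> \<bar>blinfun_apply (T - S) x \<bullet> y\<bar>"
      by (intro tendsto_rabs tendsto_inner blinfun.tendsto tendsto_const proj_lessThan_tendsto)
  qed (use trunc in auto)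
  show ?thesis
  proof (rule norm_blinfun_bound)
    show "norm (blinfun_apply (T - S) x) \<le> 4 ^ Suc N * alpha T \<X> * norm x" for x
    proof (cases "blinfun_apply (T - S) x = 0")
      case True
      then show ?thesis using alpha_nonneg by simp
    next
      case False
      have "norm (blinfun_apply (T - S) x) * norm (blinfun_apply (T - S) x)
          \<le> 4 ^ Suc N * alpha T \<X> * norm x * norm (blinfun_apply (T - S) x)"
        using bound[of x "blinfun_apply (T - S) x"] by (simp only: power2_norm_eq_inner[symmetric] power2_eq_square abs_mult abs_norm_cancel)
      then show ?thesis by (rule mult_right_le_imp_le) (use False in simp)
    qed
  qed (use alpha_nonneg in simp)
qed

section \<open>Weak* continuity\<close>

lemma sum_norm_coord_mult_le:
  "(\<Sum>i<n. cmod (coord x i) * cmod (coord y i)) \<le> norm x * norm y"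
proof -
  have "(\<Sum>i<n. cmod (coord x i) * cmod (coord y i))\<^sup>2
      \<le> (\<Sum>i<n. (cmod (coord x i))\<^sup>2) * (\<Sum>i<n. (cmod (coord y i))\<^sup>2)"
    by (rule Cauchy_Schwarz_ineq_sum)
  also have "\<dots> \<le> (norm x)\<^sup>2 * (norm y)\<^sup>2"
    by (intro mult_mono sum_cmod_coord_le sum_nonneg) auto
  finally have "(\<Sum>i<n. cmod (coord x i) * cmod (coord y i))\<^sup>2 \<le> (norm x * norm y)\<^sup>2"
    by (simp only: power_mult_distrib)
  then show ?thesis by (rule power2_le_imp_le) simp
qed

lemma summable_cinner: "summable (\<lambda>i. cmod (coord x i * cnj (coord y i)))"
  by (rule summableI_nonneg_bounded[of _ "norm x * norm y"])
    (use sum_norm_coord_mult_le in \<open>simp_all add: norm_mult\<close>)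

lemma cinner_sums: "(\<lambda>i. coord x i * cnj (coord y i)) sums cinner x y"
  unfolding cinner.rep_eq by (rule summable_sums[OF summable_norm_cancel[OF summable_cinner]])

lemma cmod_cinner_le: "cmod (cinner x y) \<le> norm x * norm y"
proof -
  have "cmod (cinner x y) \<le> (\<Sum>i. cmod (coord x i * cnj (coord y i)))"
    unfolding cinner.rep_eq by (rule summable_norm[OF summable_cinner])
  also have "\<dots> \<le> norm x * norm y"
    by (rule suminf_le_const[OF summable_cinner])
      (use sum_norm_coord_mult_le in \<open>simp add: norm_mult\<close>)
  finally show ?thesis .
qed

lemma cinner_add_left: "cinner (x + y) z = cinner x z + cinner y z"
  by (rule sums_unique2[OF cinner_sums])
    (use sums_add[OF cinner_sums cinner_sums, of x z y z] in \<open>simp add: algebra_simps\<close>)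

lemma cinner_scaleC_left: "cinner (c *\<^sub>C x) z = c * cinner x z"
  by (rule sums_unique2[OF cinner_sums])
    (use sums_mult[OF cinner_sums, of c x z] in \<open>simp add: mult.assoc\<close>)

lemma bounded_linear_cinner_left: "bounded_linear (\<lambda>x. cinner x y)"
proof (rule bounded_linear_intro[of _ "norm y"])
  show "cinner (r *\<^sub>R x) y = r *\<^sub>R cinner x y" for r x
  proof -
    have "r *\<^sub>R x = complex_of_real r *\<^sub>C x" by (rule ell2_eqI) simp
    then show ?thesis by (simp only: cinner_scaleC_left scaleR_conv_of_real)
  qed
qed (simp_all add: cinner_add_left cmod_cinner_le)

lemma cinner_proj: "cinner (proj A x) y = cinner x (proj A y)"
  unfolding cinner.rep_eq by (rule arg_cong[of _ _ suminf]) auto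

lemma cinner_scaleC_basis_vec_right: "cinner x (c *\<^sub>C basis_vec k) = coord x k * cnj c"
proof -
  have "(\<Sum>i. coord x i * cnj (coord (c *\<^sub>C basis_vec k) i))
      = (\<Sum>i\<in>{k}. coord x i * cnj (coord (c *\<^sub>C basis_vec k) i))"
    by (rule suminf_finite) (auto simp: coord_basis_vec)
  then show ?thesis by (simp add: cinner.rep_eq coord_basis_vec)
qed

section \<open>Double series as weak* functionals\<close>

text \<open>Double counting: each coordinate survives in at most \<open>N\<close> of the
  projections.\<close>

lemma sum_norm_proj_squared_le:
  fixes E :: "nat \<Rightarrow> nat set"
  assumes E: "\<And>i. finite {k. i \<in> E k} \<and> card {k. i \<in> E k} \<le> N"
  shows "(\<Sum>k<L. (norm (proj (E k) x))\<^sup>2) \<le> N * (norm x)\<^sup>2"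
proof -
  have "(\<Sum>k<L. (norm (proj (E k) x))\<^sup>2) = (\<Sum>i. \<Sum>k<L. (cmod (coord (proj (E k) x) i))\<^sup>2)"
    unfolding norm_ell2_squared by (rule suminf_sum[symmetric]) (rule summable_coord)
  also have "\<dots> \<le> (\<Sum>i. N * (cmod (coord x i))\<^sup>2)"
  proof (intro suminf_le summable_sum summable_coord summable_mult)
    fix i
    have "(\<Sum>k<L. (cmod (coord (proj (E k) x) i))\<^sup>2) = (\<Sum>k\<in>{..<L} \<inter> {k. i \<in> E k}. (cmod (coord x i))\<^sup>2)"
      by (subst sum.inter_restrict) (auto intro!: sum.cong)
    also have "\<dots> = real (card ({..<L} \<inter> {k. i \<in> E k})) * (cmod (coord x i))\<^sup>2" by simp
    also have "\<dots> \<le> N * (cmod (coord x i))\<^sup>2"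
      using E[of i] by (intro mult_right_mono) (auto intro: order_trans[OF card_mono])
    finally show "(\<Sum>k<L. (cmod (coord (proj (E k) x) i))\<^sup>2) \<le> N * (cmod (coord x i))\<^sup>2" .
  qed
  also have "\<dots> = N * (norm x)\<^sup>2" by (simp add: suminf_mult summable_coord norm_ell2_squared)
  finally show ?thesis .
qed

text \<open>Both components of a code are at most the code, so the first \<open>M\<close> codes lie
  in a square of side \<open>M\<close>, whose sum is bounded row by row.\<close>

lemma summable_prod_decode:
  fixes f :: "nat \<Rightarrow> nat \<Rightarrow> real"
  assumes "\<And>n k. 0 \<le> f n k" "\<And>n L. (\<Sum>k<L. f n k) \<le> c n" "summable c"
  shows "summable (\<lambda>m. case prod_decode m of (n, k) \<Rightarrow> f n k)"
proof (rule summableI_nonneg_bounded)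
  show "0 \<le> (case prod_decode m of (n, k) \<Rightarrow> f n k)" for m
    using assms(1) by (simp split: prod.split)
  have c: "0 \<le> c n" for n using assms(2)[of n 0] by simp
  show "(\<Sum>m<M. case prod_decode m of (n, k) \<Rightarrow> f n k) \<le> suminf c" for M
  proof -
    have "(\<Sum>m<M. case prod_decode m of (n, k) \<Rightarrow> f n k) = (\<Sum>(n, k)\<in>prod_decode ` {..<M}. f n k)"
      by (subst sum.reindex) (auto simp: inj_on_def dest: injD[OF inj_prod_decode])
    also have "\<dots> \<le> (\<Sum>(n, k)\<in>{..<M} \<times> {..<M}. f n k)"
    proof (rule sum_mono2)
      show "prod_decode ` {..<M} \<subseteq> {..<M} \<times> {..<M}"
      proof
        fix e assume "e \<in> prod_decode ` {..<M}"
        then obtain m where m: "e = prod_decode m" "m < M" by auto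
        obtain a b where ab: "e = (a, b)" by (cases e)
        then have "prod_encode (a, b) = m" using m(1) by (metis prod_decode_inverse)
        then show "e \<in> {..<M} \<times> {..<M}"
          using m(2) ab le_prod_encode_1[of a b] le_prod_encode_2[of b a] by auto
      qed
    qed (use assms(1) in auto)
    also have "\<dots> = (\<Sum>n<M. \<Sum>k<M. f n k)" by (rule sum.cartesian_product[symmetric])
    also have "\<dots> \<le> (\<Sum>n<M. c n)" by (intro sum_mono assms(2))
    also have "\<dots> \<le> suminf c" by (rule sum_le_suminf[OF assms(3)]) (auto simp: c)
    finally show ?thesis .
  qed
qed

lemma cmod_cinner_apply_le: "cmod (cinner (blinfun_apply T u) v) \<le> norm T * (norm u * norm v)"
proof -
  have "cmod (cinner (blinfun_apply T u) v) \<le> norm (blinfun_apply T u) * norm v" by (rule cmod_cinner_le)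
  also have "\<dots> \<le> (norm T * norm u) * norm v" by (intro mult_right_mono norm_blinfun norm_ge_zero)
  finally show ?thesis by (simp only: mult.assoc)
qed

text \<open>Weak* functionals are given by single series, so the double family is enumerated through
  \<open>prod_decode\<close>. Cauchy-Schwarz makes the series absolutely convergent, and summing it
  by rows recovers the values \<open>G T n\<close>.\<close>

lemma weak_star_functional_double:
  fixes u v :: "nat \<Rightarrow> nat \<Rightarrow> ell2"
  assumes u: "\<And>n L. (\<Sum>k<L. (norm (u n k))\<^sup>2) \<le> c n" "summable c"
    and v: "\<And>n L. (\<Sum>k<L. (norm (v n k))\<^sup>2) \<le> d n" "summable d"
    and G: "\<And>T n. T \<in> BH \<Longrightarrow> (\<lambda>k. cinner (blinfun_apply T (u n k)) (v n k)) sums G T n"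
  shows "\<exists>\<omega>\<in>weak_star_functionals. \<forall>T\<in>BH. (\<Sum>n. G T n) = \<omega> T"
proof -
  define U V where "U m = (case prod_decode m of (n, k) \<Rightarrow> u n k)"
    and "V m = (case prod_decode m of (n, k) \<Rightarrow> v n k)" for m
  have "summable (\<lambda>m. case prod_decode m of (n, k) \<Rightarrow> (norm (u n k))\<^sup>2)"
    by (rule summable_prod_decode[OF _ u]) simp
  then have U: "summable (\<lambda>m. (norm (U m))\<^sup>2)" by (simp add: U_def case_prod_unfold)
  have "summable (\<lambda>m. case prod_decode m of (n, k) \<Rightarrow> (norm (v n k))\<^sup>2)"
    by (rule summable_prod_decode[OF _ v]) simp
  then have V: "summable (\<lambda>m. (norm (V m))\<^sup>2)" by (simp add: V_def case_prod_unfold)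
  have "(\<Sum>n. G T n) = (\<Sum>m. cinner (blinfun_apply T (U m)) (V m))" if T: "T \<in> BH" for T
  proof -
    define g where "g = (\<lambda>(n, k). cinner (blinfun_apply T (u n k)) (v n k))"
    have g: "g (prod_decode m) = cinner (blinfun_apply T (U m)) (V m)" for m
      by (simp add: g_def U_def V_def case_prod_unfold)
    have "summable (\<lambda>m. norm (g (prod_decode m)))"
      by (rule summable_comparison_test'[OF summable_mult[OF summable_prod[OF U V], of "norm T"]])
        (simp add: g cmod_cinner_apply_le)
    then have "((\<lambda>m. g (prod_decode m)) has_sum (\<Sum>m. g (prod_decode m))) UNIV"
      by (intro norm_summable_imp_has_sum summable_sums summable_norm_cancel[of "\<lambda>m. g (prod_decode m)"])
    then have "(g has_sum (\<Sum>m. g (prod_decode m))) (UNIV \<times> UNIV)"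
      using has_sum_reindex_bij_betw[OF bij_prod_decode, of g] by simp
    moreover have "((\<lambda>k. g (n, k)) has_sum G T n) UNIV" for n
    proof (rule norm_summable_imp_has_sum)
      have "summable (\<lambda>k. (norm (u n k))\<^sup>2)" "summable (\<lambda>k. (norm (v n k))\<^sup>2)"
        by (rule summableI_nonneg_bounded[OF _ u(1)], simp, rule summableI_nonneg_bounded[OF _ v(1)], simp)
      then have "summable (\<lambda>k. norm T * (norm (u n k) * norm (v n k)))"
        by (intro summable_mult summable_prod)
      then show "summable (\<lambda>k. norm (g (n, k)))"
        by (rule summable_comparison_test') (simp add: g_def cmod_cinner_apply_le)
      show "(\<lambda>k. g (n, k)) sums G T n" using G[OF T, of n] by (simp add: g_def)
    qed
    ultimately have "(G T has_sum (\<Sum>m. g (prod_decode m))) UNIV"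
      by (rule has_sum_SigmaD)
    then have "G T sums (\<Sum>m. g (prod_decode m))" by (rule has_sum_imp_sums)
    then show ?thesis by (simp only: sums_unique[symmetric] g)
  qed
  moreover have "(\<lambda>T. \<Sum>m. cinner (blinfun_apply T (U m)) (V m)) \<in> weak_star_functionals"
    unfolding weak_star_functionals_def using U V by blast
  ultimately show ?thesis by (intro bexI) auto
qed

text \<open>
  For \<open>S = \<Phi>\<^sub>R(T)\<close> one has \<open>\<langle>S \<xi>, \<eta>\<rangle> = \<Sum>k. \<langle>T (\<xi>\<^sub>k e\<^sub>k), P\<^sub>k \<eta>\<rangle>\<close> with \<open>P\<^sub>k\<close> the projection onto the
  \<open>k\<close>-th column of \<open>R\<close>; the vectors \<open>P\<^sub>k \<eta>\<close> are square-summable because a row index lies in at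
  most \<open>N\<close> columns of \<open>R\<close>. The column part is dual.
\<close>

lemma row_part_functional:
  assumes split: "row_column_split N R C" and S: "\<And>T. T \<in> BH \<Longrightarrow> is_schur_product (indicator R) T (S T)"
    and \<xi>: "summable (\<lambda>n. (norm (\<xi> n))\<^sup>2)" and \<eta>: "summable (\<lambda>n. (norm (\<eta> n))\<^sup>2)"
  shows "\<exists>\<omega>\<in>weak_star_functionals. \<forall>T\<in>BH. (\<Sum>n. cinner (blinfun_apply (S T) (\<xi> n)) (\<eta> n)) = \<omega> T"
proof (rule weak_star_functional_double)
  let ?u = "\<lambda>n k. coord (\<xi> n) k *\<^sub>C basis_vec k" and ?v = "\<lambda>n k. proj {i. (i, k) \<in> R} (\<eta> n)"
  show "(\<Sum>k<L. (norm (?u n k))\<^sup>2) \<le> (norm (\<xi> n))\<^sup>2" for n L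
    by (simp add: norm_scaleC sum_cmod_coord_le)
  show "(\<Sum>k<L. (norm (?v n k))\<^sup>2) \<le> N * (norm (\<eta> n))\<^sup>2" for n L
    by (rule sum_norm_proj_squared_le) (use split in \<open>simp add: row_column_split_def\<close>)
  show "summable (\<lambda>n. N * (norm (\<eta> n))\<^sup>2)" by (rule summable_mult[OF \<eta>])
  fix T n assume T: "T \<in> BH"
  have ST: "S T \<in> BH" "entry (S T) p = indicator R p * entry T p" for p
    using S[OF T] unfolding is_schur_product_def by blast+
  have col: "blinfun_apply (S T) (basis_vec k) = proj {i. (i, k) \<in> R} (blinfun_apply T (basis_vec k))" for k
    by (rule ell2_eqI) (simp add: entry_eq_coord[symmetric] ST indicator_def)
  have "(\<lambda>m. cinner (\<Sum>k<m. coord (\<xi> n) k *\<^sub>C blinfun_apply (S T) (basis_vec k)) (\<eta> n))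
      \<longlonglongrightarrow> cinner (blinfun_apply (S T) (\<xi> n)) (\<eta> n)"
    by (rule bounded_linear.tendsto[OF bounded_linear_cinner_left apply_basis_tendsto[OF ST(1)]])
  moreover have "cinner (\<Sum>k<m. coord (\<xi> n) k *\<^sub>C blinfun_apply (S T) (basis_vec k)) (\<eta> n)
      = (\<Sum>k<m. cinner (blinfun_apply T (?u n k)) (?v n k))" for m
    by (simp add: bounded_linear.linear[OF bounded_linear_cinner_left, THEN linear_sum]
        cinner_scaleC_left col cinner_proj BH_scaleC[OF T])
  ultimately show "(\<lambda>k. cinner (blinfun_apply T (?u n k)) (?v n k))
      sums cinner (blinfun_apply (S T) (\<xi> n)) (\<eta> n)"
    by (simp add: sums_def)
qed (rule \<xi>)

lemma column_part_functional:
  assumes split: "row_column_split N R C" and S: "\<And>T. T \<in> BH \<Longrightarrow> is_schur_product (indicator C) T (S T)"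
    and \<xi>: "summable (\<lambda>n. (norm (\<xi> n))\<^sup>2)" and \<eta>: "summable (\<lambda>n. (norm (\<eta> n))\<^sup>2)"
  shows "\<exists>\<omega>\<in>weak_star_functionals. \<forall>T\<in>BH. (\<Sum>n. cinner (blinfun_apply (S T) (\<xi> n)) (\<eta> n)) = \<omega> T"
proof (rule weak_star_functional_double)
  let ?u = "\<lambda>n k. proj {j. (k, j) \<in> C} (\<xi> n)" and ?v = "\<lambda>n k. coord (\<eta> n) k *\<^sub>C basis_vec k"
  show "(\<Sum>k<L. (norm (?u n k))\<^sup>2) \<le> N * (norm (\<xi> n))\<^sup>2" for n L
    by (rule sum_norm_proj_squared_le) (use split in \<open>simp add: row_column_split_def\<close>)
  show "summable (\<lambda>n. N * (norm (\<xi> n))\<^sup>2)" by (rule summable_mult[OF \<xi>])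
  show "(\<Sum>k<L. (norm (?v n k))\<^sup>2) \<le> (norm (\<eta> n))\<^sup>2" for n L
    by (simp add: norm_scaleC sum_cmod_coord_le)
  fix T n assume T: "T \<in> BH"
  have ST: "S T \<in> BH" "entry (S T) p = indicator C p * entry T p" for p
    using S[OF T] unfolding is_schur_product_def by blast+
  \<comment> \<open>Row \<open>k\<close> of \<open>S T\<close> sees only the coordinates in row
    \<open>k\<close> of \<open>C\<close>, so it acts as row \<open>k\<close> of \<open>T\<close>
    does on the projected vector.\<close>
  have "coord (blinfun_apply (S T) (\<xi> n)) k = coord (blinfun_apply T (?u n k)) k" for k
  proof (rule sums_unique2[OF coord_apply_sums[OF ST(1)]])
    have "(\<lambda>j. entry T (k, j) * coord (?u n k) j) = (\<lambda>j. entry (S T) (k, j) * coord (\<xi> n) j)"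
      by (auto simp: ST indicator_def fun_eq_iff)
    then show "(\<lambda>j. entry (S T) (k, j) * coord (\<xi> n) j) sums coord (blinfun_apply T (?u n k)) k"
      using coord_apply_sums[OF T, of k "?u n k"] by simp
  qed
  then show "(\<lambda>k. cinner (blinfun_apply T (?u n k)) (?v n k)) sums cinner (blinfun_apply (S T) (\<xi> n)) (\<eta> n)"
    using cinner_sums[of "blinfun_apply (S T) (\<xi> n)" "\<eta> n"] by (simp add: cinner_scaleC_basis_vec_right)
qed (rule \<eta>)

section \<open>Continuity of the pattern map and membership in \<open>frakH\<close>\<close>

lemma continuous_map_weak_star_functional:
  assumes "\<omega> \<in> weak_star_functionals"
  shows "continuous_map weak_star euclidean \<omega>"
  unfolding continuous_map
proof (intro conjI allI impI)
  fix U :: "complex set" assume "openin euclidean U"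
  then have "open U" by (rule open_openin[THEN iffD2])
  then have "{T \<in> BH. \<omega> T \<in> U} \<in> {{T \<in> BH. \<omega> T \<in> U} | \<omega> U. \<omega> \<in> weak_star_functionals \<and> open U}"
    using assms by blast
  then show "openin weak_star {T \<in> topspace weak_star. \<omega> T \<in> U}"
    unfolding topspace_weak_star unfolding weak_star_def by (rule topology_generated_by_Basis)
qed simp

text \<open>As \<open>R\<close> and \<open>C\<close> are disjoint, the indicator of the union is the
  sum of the two indicators. Composing with the Schur product thus turns \<omega> into a sum of two
  weak* functionals.\<close>

lemma weak_star_functional_schur_product_continuous:
  assumes split: "row_column_split N R C"
    and mR: "schur_multiplier_function (indicator R)" and mC: "schur_multiplier_function (indicator C)"
    and \<omega>: "\<omega> \<in> weak_star_functionals"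
  shows "continuous_map weak_star euclidean (\<lambda>T. \<omega> (entrywise_mult (indicator (R \<union> C)) T))"
proof -
  obtain \<xi> \<eta> where \<omega>_eq: "\<omega> = (\<lambda>T. \<Sum>n. cinner (blinfun_apply T (\<xi> n)) (\<eta> n))"
    and \<xi>: "summable (\<lambda>n. (norm (\<xi> n))\<^sup>2)" and \<eta>: "summable (\<lambda>n. (norm (\<eta> n))\<^sup>2)"
    using \<omega> unfolding weak_star_functionals_def by blast
  define SR SC where "SR = entrywise_mult (indicator R)" and "SC = entrywise_mult (indicator C)"
  have SR: "is_schur_product (indicator R) T (SR T)" and SC: "is_schur_product (indicator C) T (SC T)"
    if "T \<in> BH" for T
    unfolding SR_def SC_def using that mR mC by (auto intro: is_schur_product_entrywise_mult)
  obtain \<omega>R where \<omega>R: "\<omega>R \<in> weak_star_functionals"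
    "\<And>T. T \<in> BH \<Longrightarrow> (\<Sum>n. cinner (blinfun_apply (SR T) (\<xi> n)) (\<eta> n)) = \<omega>R T"
    using row_part_functional[OF split SR \<xi> \<eta>] by blast
  obtain \<omega>C where \<omega>C: "\<omega>C \<in> weak_star_functionals"
    "\<And>T. T \<in> BH \<Longrightarrow> (\<Sum>n. cinner (blinfun_apply (SC T) (\<xi> n)) (\<eta> n)) = \<omega>C T"
    using column_part_functional[OF split SC \<xi> \<eta>] by blast
  have summable: "summable (\<lambda>n. cinner (blinfun_apply T (\<xi> n)) (\<eta> n))" for T
    by (rule summable_comparison_test'[OF summable_mult[OF summable_prod[OF \<xi> \<eta>], of "norm T"]])
      (rule cmod_cinner_apply_le)
  have "\<omega> (entrywise_mult (indicator (R \<union> C)) T) = \<omega>R T + \<omega>C T" if T: "T \<in> BH" for T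
  proof -
    have "is_schur_product (indicator (R \<union> C)) T (SR T + SC T)"
      using SR[OF T] SC[OF T] split
      by (auto simp: is_schur_product_def BH_add entry_add row_column_split_def indicator_def)
    then have "entrywise_mult (indicator (R \<union> C)) T = SR T + SC T" by (rule entrywise_mult_eqI)
    then show ?thesis
      by (simp add: \<omega>_eq blinfun.add_left cinner_add_left suminf_add[OF summable summable, symmetric]
          \<omega>R(2)[OF T] \<omega>C(2)[OF T])
  qed
  moreover have "continuous_map weak_star euclidean (\<lambda>T. \<omega>R T + \<omega>C T)"
    by (intro continuous_map_add continuous_map_weak_star_functional \<omega>R(1) \<omega>C(1))
  ultimately show ?thesis
    by (subst continuous_map_eq[where f = "\<lambda>T. \<omega>R T + \<omega>C T"]) (simp_all add: topspace_weak_star)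
qed

theorem proposition3p14:
  fixes \<kappa> :: "(nat \<times> nat) set"
  assumes "schur_bounded_pattern \<kappa>"
  shows "pattern_map \<kappa> \<in> frakH"
proof -
  \<comment> \<open>A bounded function supported on a subset of \<kappa> is supported on \<kappa>,
    so \<open>R\<close> and \<open>C\<close> separately give multipliers too.\<close>
  have mult: "schur_multiplier_function (indicator E)" if "E \<subseteq> \<kappa>" for E
  proof -
    have "bounded (range (indicator E :: nat \<times> nat \<Rightarrow> complex))"
      by (rule boundedI[of _ 1]) (auto simp: indicator_def)
    moreover have "indicator E p = (0 :: complex)" if "p \<notin> \<kappa>" for p
      using that \<open>E \<subseteq> \<kappa>\<close> by (auto simp: indicator_def)
    ultimately show ?thesis using assms unfolding schur_bounded_pattern_def by blast
  qed
  obtain N R C where \<kappa>: "\<kappa> = R \<union> C" and split: "row_column_split N R C"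
    using schur_bounded_pattern_split[OF assms] by blast
  have sp: "is_schur_product (indicator \<kappa>) T (pattern_map \<kappa> T)" if "T \<in> BH" for T
    unfolding pattern_map_def using mult that by (auto intro: is_schur_product_entrywise_mult)
  then have BH: "pattern_map \<kappa> T \<in> BH" and entry: "entry (pattern_map \<kappa> T) p = indicator \<kappa> p * entry T p"
    if "T \<in> BH" for T p
    using that unfolding is_schur_product_def by blast+
  have "continuous_map weak_star weak_star (pattern_map \<kappa>)"
  \<comment> \<open>It suffices to look at the generating sets, each cut out by one functional; its
    preimage is cut out by that functional composed with the pattern map.\<close>
  proof (subst (2) weak_star_def, rule continuous_on_generated_topo)
    fix W assume "W \<in> {{T \<in> BH. \<omega> T \<in> U} | \<omega> U. \<omega> \<in> weak_star_functionals \<and> open U}"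
    then obtain \<omega> U where W: "W = {T \<in> BH. \<omega> T \<in> U}" and \<omega>: "\<omega> \<in> weak_star_functionals" and "open U"
      by blast
    have "continuous_map weak_star euclidean (\<lambda>T. \<omega> (pattern_map \<kappa> T))"
      unfolding pattern_map_def \<kappa>
      by (rule weak_star_functional_schur_product_continuous[OF split mult mult \<omega>]) (auto simp: \<kappa>)
    then have "openin weak_star {T \<in> topspace weak_star. \<omega> (pattern_map \<kappa> T) \<in> U}"
      by (rule openin_continuous_map_preimage) (rule open_openin[THEN iffD1, OF \<open>open U\<close>])
    moreover have "pattern_map \<kappa> -` W \<inter> topspace weak_star = {T \<in> topspace weak_star. \<omega> (pattern_map \<kappa> T) \<in> U}"
      using BH by (auto simp: W topspace_weak_star)
    ultimately show "openin weak_star (pattern_map \<kappa> -` W \<inter> topspace weak_star)" by simp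
  next
    have "pattern_map \<kappa> ` topspace weak_star \<subseteq> topspace weak_star"
      using BH by (auto simp: topspace_weak_star)
    then show "pattern_map \<kappa> ` topspace weak_star
        \<subseteq> \<Union> {{T \<in> BH. \<omega> T \<in> U} | \<omega> U. \<omega> \<in> weak_star_functionals \<and> open U}"
      unfolding weak_star_def topology_generated_by_topspace .
  qed
  moreover have "diagonal_bimodule_map (pattern_map \<kappa>)"
    unfolding pattern_map_def by (intro diagonal_bimodule_map_entrywise_mult mult) simp
  moreover have "pattern_map \<kappa> (pattern_map \<kappa> T) = pattern_map \<kappa> T" if "T \<in> BH" for T
    using that by (intro BH_eqI) (simp_all add: BH entry indicator_def)
  ultimately have "schur_idempotent (pattern_map \<kappa>)"
    by (simp add: schur_idempotent_def schur_multiplier_def)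
  \<comment> \<open>Matrices in the range are supported on \<kappa>, and 0 is among them: this is
    what the distance estimate asks of the subspace. The constant depends on the splitting only, not
    on \<open>T\<close>.\<close>
  moreover have "norm (perp (pattern_map \<kappa>) T) \<le> 4 ^ Suc N * alpha T (ran (pattern_map \<kappa>))"
    if T: "T \<in> BH" for T
    unfolding perp_def
  proof (rule norm_perp_le_alpha[OF T _ split])
    show "is_schur_product (indicator (R \<union> C)) T (pattern_map \<kappa> T)" using sp[OF T] by (simp only: \<kappa>)
    have "pattern_map \<kappa> 0 = 0" by (rule BH_eqI) (simp_all add: BH entry)
    then show "0 \<in> ran (pattern_map \<kappa>)" unfolding ran_def by (metis BH_zero imageI)
    show "X \<in> BH" if "X \<in> ran (pattern_map \<kappa>)" for X using that BH by (auto simp: ran_def)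
    show "entry X p = 0" if X: "X \<in> ran (pattern_map \<kappa>)" and p: "p \<notin> R \<union> C" for X p
    proof -
      obtain T' where "X = pattern_map \<kappa> T'" "T' \<in> BH" using X by (auto simp: ran_def)
      then show ?thesis using entry[of T' p] p by (simp add: \<kappa>)
    qed
  qed
  ultimately show ?thesis unfolding frakH_def
    by (intro CollectI conjI exI[of _ "4 ^ Suc N"]) auto
qed

end
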